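(* Let $\mathcal{M}$ be a compact, smooth, $n$-dimensional Riemannian manifold without boundary. Let $G:[0,\infty)\to\mathbb{R}$ be nonnegative, decreasing and continuous with $0<G(0)=C$ and $\lim_{x\to\infty}G(x)=0$, and let $\{\psi_j\}_{j\in\mathbb{Z}}$ be the wavelets generated by $G$. Then $$\|\overline{S}_2^mf\|_{\ell^2(\mathbb{Z}^m)}^2\le C^{2m}\,\|f\|_{\mathbf{L}^2(\mathcal{M})}^2$$ for all $f\in\mathbf{L}^2(\mathcal{M})$ and all $m\ge1$.
   Context: Setting: $\mathcal{M}$ is a compact, smooth, $n$-dimensional Riemannian manifold without boundary contained in $\mathbb{R}^d$, $d\ge n$, with Riemannian volume measure $\mu$ and Laplace-Beltrami operator $\Delta$. $\mathbf{L}^2(\mathcal{M})$ is the space of square-integrable $f:\mathcal{M}\to\mathbb{R}$. The eigenvalues of $-\Delta$ in increasing order are $\{\lambda_k\}_{k\in\mathbb{N}_0}$, with corresponding eigenfunctions $\{e_k\}_{k\in\mathbb{N}_0}$ forming an orthonormal basis of $\mathbf{L}^2(\mathcal{M})$, and $\hat f(k)=\int_{\mathcal{M}}f\,\overline{e_k}\,d\mu$. Wavelets: for $j\in\mathbb{Z}$, $\hat\psi_j(k)=\left[|G(2^{j-1}\lambda_k)|^2-|G(2^j\lambda_k)|^2\right]^{1/2}$, and $f\ast\psi_j=\sum_{k\in\mathbb{N}_0}\hat f(k)\hat\psi_j(k)e_k$. Scattering: $U[j]f=|f\ast\psi_j|$, $U[j_1,\dots,j_m]f=U[j_m]\cdots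 U[j_1]f$, $\overline{S}_2^m[j_1,\dots,j_m]f=\|U[j_1,\dots,j_m]f\|_{\mathbf{L}^2(\mathcal{M})}$ for $(j_1,\dots,j_m)\in\mathbb{Z}^m$. $\overline{S}_2^mf$ is the family of these numbers, and $\|a\|_{\ell^2(\mathbb{Z}^m)}^2=\sum_{(j_1,\dots,j_m)\in\mathbb{Z}^m}|a(j_1,\dots,j_m)|^2$. *)

theory Defs
  imports "HOL-Analysis.Analysis"
begin

section \<open>Smooth maps and embedded submanifolds\<close>

fun Ck_on :: "nat \<Rightarrow> 'a::real_normed_vector set \<Rightarrow> ('a \<Rightarrow> 'b::real_normed_vector) \<Rightarrow> bool" where
  "Ck_on 0 S f \<longleftrightarrow> continuous_on S f"
| "Ck_on (Suc k) S f \<longleftrightarrow>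
     (\<forall>x\<in>S. f differentiable (at x)) \<and> (\<forall>v. Ck_on k S (\<lambda>x. frechet_derivative f (at x) v))"

text \<open>\<open>smooth_on\<close> is only used on open sets.\<close>

definition smooth_on :: "'a::real_normed_vector set \<Rightarrow> ('a \<Rightarrow> 'b::real_normed_vector) \<Rightarrow> bool" where
  "smooth_on S f \<longleftrightarrow> (\<forall>k. Ck_on k S f)"

text \<open>The inverse of a coordinate chart: a smooth immersion that is a homeomorphism from an open
  subset of \<open>\<real>\<^sup>n\<close> onto a relatively open subset of \<open>M\<close>.\<close>

definition local_param :: "(real^'d) set \<Rightarrow> (real^'n) set \<Rightarrow> (real^'n \<Rightarrow> real^'d) \<Rightarrow> bool" where
  "local_param M U \<phi> \<longleftrightarrow>
     open U \<and> smooth_on U \<phi> \<and> (\<forall>x\<in>U. inj (frechet_derivative \<phi> (at x))) \<and>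
     openin (top_of_set M) (\<phi> ` U) \<and> (\<exists>\<psi>. homeomorphism U (\<phi> ` U) \<phi> \<psi>)"

text \<open>The dimension \<open>n\<close> is the cardinality of the index type \<open>'n\<close>. Every point has a neighbourhood
  parametrised by an open subset of \<open>\<real>\<^sup>n\<close>, so there is no boundary.\<close>

definition smooth_submanifold :: "'n::finite itself \<Rightarrow> (real^'d) set \<Rightarrow> bool" where
  "smooth_submanifold _ M \<longleftrightarrow>
     (\<forall>p\<in>M. \<exists>(U :: (real^'n) set) \<phi>. local_param M U \<phi> \<and> p \<in> \<phi> ` U)"

definition smooth_function ::
    "'n::finite itself \<Rightarrow> (real^'d) set \<Rightarrow> (real^'d \<Rightarrow> 'b::real_normed_vector) \<Rightarrow> bool" where
  "smooth_function _ M f \<longleftrightarrow>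
     (\<forall>(U :: (real^'n) set) \<phi>. local_param M U \<phi> \<longrightarrow> smooth_on U (\<lambda>x. f (\<phi> x)))"

definition tangent_space :: "'n::finite itself \<Rightarrow> (real^'d) set \<Rightarrow> real^'d \<Rightarrow> (real^'d) set" where
  "tangent_space _ M p =
     {v. \<exists>(U :: (real^'n) set) \<phi> x. local_param M U \<phi> \<and> x \<in> U \<and> \<phi> x = p \<and>
           v \<in> range (frechet_derivative \<phi> (at x))}"

definition partial_deriv :: "'n::finite \<Rightarrow> (real^'n \<Rightarrow> 'b::real_normed_vector) \<Rightarrow> real^'n \<Rightarrow> 'b" where
  "partial_deriv i f x = frechet_derivative f (at x) (axis i 1)"


section \<open>Riemannian metric, volume measure and Laplace-Beltrami operator\<close>

definition metric_matrix ::
    "(real^'d \<Rightarrow> real^'d \<Rightarrow> real^'d \<Rightarrow> real) \<Rightarrow> (real^'n \<Rightarrow> real^'d) \<Rightarrow> real^'n \<Rightarrow> real^'n^'n::finite" where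
  "metric_matrix g \<phi> x = (\<chi> i j. g (\<phi> x) (partial_deriv i \<phi> x) (partial_deriv j \<phi> x))"

text \<open>\<open>g p\<close> only matters on the tangent space at \<open>p\<close>. The metric is arbitrary; it need not be the
  one induced by the Euclidean inner product.\<close>

definition riemannian_metric ::
    "'n::finite itself \<Rightarrow> (real^'d) set \<Rightarrow> (real^'d \<Rightarrow> real^'d \<Rightarrow> real^'d \<Rightarrow> real) \<Rightarrow> bool" where
  "riemannian_metric T M g \<longleftrightarrow>
     (\<forall>p\<in>M. \<forall>u\<in>tangent_space T M p. \<forall>v\<in>tangent_space T M p. \<forall>w\<in>tangent_space T M p. \<forall>a b.
        g p (a *\<^sub>R u + b *\<^sub>R v) w = a * g p u w + b * g p v w) \<and>
     (\<forall>p\<in>M. \<forall>u\<in>tangent_space T M p. \<forall>v\<in>tangent_space T M p. g p u v = g p v u) \<and>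
     (\<forall>p\<in>M. \<forall>v\<in>tangent_space T M p. v \<noteq> 0 \<longrightarrow> g p v v > 0) \<and>
     (\<forall>(U :: (real^'n) set) \<phi> i j. local_param M U \<phi> \<longrightarrow>
        smooth_on U (\<lambda>x. metric_matrix g \<phi> x $ i $ j))"

definition volume_density ::
    "(real^'d \<Rightarrow> real^'d \<Rightarrow> real^'d \<Rightarrow> real) \<Rightarrow> (real^'n::finite \<Rightarrow> real^'d) \<Rightarrow> real^'n \<Rightarrow> real" where
  "volume_density g \<phi> x = sqrt (det (metric_matrix g \<phi> x))"

text \<open>The Riemannian volume is the Borel measure given by \<open>sqrt (det g) dx\<close> in every chart; this
  determines it uniquely.\<close>

definition riemannian_volume ::
    "'n::finite itself \<Rightarrow> (real^'d) set \<Rightarrow> (real^'d \<Rightarrow> real^'d \<Rightarrow> real^'d \<Rightarrow> real) \<Rightarrow>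
     (real^'d) measure \<Rightarrow> bool" where
  "riemannian_volume _ M g \<mu> \<longleftrightarrow>
     space \<mu> = M \<and> sets \<mu> = sets (restrict_space borel M) \<and>
     (\<forall>(U :: (real^'n) set) \<phi> A. local_param M U \<phi> \<longrightarrow> A \<in> sets borel \<longrightarrow> A \<subseteq> U \<longrightarrow>
        emeasure \<mu> (\<phi> ` A) = (\<integral>\<^sup>+x\<in>A. ennreal (volume_density g \<phi> x) \<partial>lborel))"

text \<open>\<open>1 / sqrt (det g) * (\<Sum>i. \<partial>\<^sub>i (sqrt (det g) * (\<Sum>j. g\<^sup>i\<^sup>j * \<partial>\<^sub>j f)))\<close>\<close>

definition laplacian_coord ::
    "(real^'d \<Rightarrow> real^'d \<Rightarrow> real^'d \<Rightarrow> real) \<Rightarrow> (real^'n::finite \<Rightarrow> real^'d) \<Rightarrow>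
     (real^'d \<Rightarrow> 'b::real_normed_vector) \<Rightarrow> real^'n \<Rightarrow> 'b" where
  "laplacian_coord g \<phi> f x =
     (1 / volume_density g \<phi> x) *\<^sub>R
     (\<Sum>i\<in>UNIV. partial_deriv i
        (\<lambda>y. volume_density g \<phi> y *\<^sub>R
           (\<Sum>j\<in>UNIV. (matrix_inv (metric_matrix g \<phi> y) $ i $ j) *\<^sub>R
              partial_deriv j (\<lambda>z. f (\<phi> z)) y)) x)"

text \<open>For smooth \<open>f\<close> the value does not depend on the parametrisation around \<open>p\<close> that is chosen.\<close>

definition laplace_beltrami ::
    "'n::finite itself \<Rightarrow> (real^'d) set \<Rightarrow> (real^'d \<Rightarrow> real^'d \<Rightarrow> real^'d \<Rightarrow> real) \<Rightarrow>
     (real^'d \<Rightarrow> 'b::real_normed_vector) \<Rightarrow> real^'d \<Rightarrow> 'b" where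
  "laplace_beltrami _ M g f p =
     (SOME y. \<exists>(U :: (real^'n) set) \<phi> x. local_param M U \<phi> \<and> x \<in> U \<and> \<phi> x = p \<and>
        y = laplacian_coord g \<phi> f x)"


section \<open>Square-integrable functions and orthonormal bases\<close>

definition square_integrable :: "'x measure \<Rightarrow> ('x \<Rightarrow> 'b::real_normed_vector) \<Rightarrow> bool" where
  "square_integrable \<mu> f \<longleftrightarrow> f \<in> borel_measurable \<mu> \<and> integrable \<mu> (\<lambda>x. (norm (f x))\<^sup>2)"

definition L2_norm :: "'x measure \<Rightarrow> ('x \<Rightarrow> 'b::real_normed_vector) \<Rightarrow> real" where
  "L2_norm \<mu> f = sqrt (\<integral>x. (norm (f x))\<^sup>2 \<partial>\<mu>)"

text \<open>The \<open>e k\<close> may be complex-valued, whence the conjugates; real-valued \<open>e k\<close> are a special case.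
  It suffices to approximate real-valued functions: by linearity this gives density of the span
  in the complex \<open>L\<^sup>2\<close> space, and for real-valued \<open>e k\<close> in the real one.\<close>

definition L2_orthonormal_basis :: "'x measure \<Rightarrow> (nat \<Rightarrow> 'x \<Rightarrow> complex) \<Rightarrow> bool" where
  "L2_orthonormal_basis \<mu> e \<longleftrightarrow>
     (\<forall>k. square_integrable \<mu> (e k)) \<and>
     (\<forall>k l. (\<integral>x. e k x * cnj (e l x) \<partial>\<mu>) = (if k = l then 1 else 0)) \<and>
     (\<forall>f :: 'x \<Rightarrow> real. square_integrable \<mu> f \<longrightarrow>
        (\<forall>\<epsilon>>0. \<exists>N c. L2_norm \<mu> (\<lambda>x. complex_of_real (f x) - (\<Sum>k<N. c k * e k x)) < \<epsilon>))"

definition fourier_coeff :: "'x measure \<Rightarrow> (nat \<Rightarrow> 'x \<Rightarrow> complex) \<Rightarrow> ('x \<Rightarrow> real) \<Rightarrow> nat \<Rightarrow> complex" where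
  "fourier_coeff \<mu> e f k = (\<integral>x. complex_of_real (f x) * cnj (e k x) \<partial>\<mu>)"


section \<open>Wavelets and the nonwindowed scattering transform\<close>

definition wavelet_coeff :: "(real \<Rightarrow> real) \<Rightarrow> (nat \<Rightarrow> real) \<Rightarrow> int \<Rightarrow> nat \<Rightarrow> real" where
  "wavelet_coeff G ev j k =
     sqrt (\<bar>G (2 powi (j - 1) * ev k)\<bar>\<^sup>2 - \<bar>G (2 powi j * ev k)\<bar>\<^sup>2)"

text \<open>A representative of the sum of the series in \<open>L\<^sup>2\<close>; it is unique up to a null set.\<close>

definition wavelet_conv ::
    "'x measure \<Rightarrow> (nat \<Rightarrow> real) \<Rightarrow> (nat \<Rightarrow> 'x \<Rightarrow> complex) \<Rightarrow> (real \<Rightarrow> real) \<Rightarrow> int \<Rightarrow>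
     ('x \<Rightarrow> real) \<Rightarrow> 'x \<Rightarrow> complex" where
  "wavelet_conv \<mu> ev e G j f =
     (SOME h. square_integrable \<mu> h \<and>
        (\<lambda>N. L2_norm \<mu> (\<lambda>x. h x -
           (\<Sum>k<N. fourier_coeff \<mu> e f k * complex_of_real (wavelet_coeff G ev j k) * e k x)))
        \<longlonglongrightarrow> 0)"

definition scatter_step ::
    "'x measure \<Rightarrow> (nat \<Rightarrow> real) \<Rightarrow> (nat \<Rightarrow> 'x \<Rightarrow> complex) \<Rightarrow> (real \<Rightarrow> real) \<Rightarrow> int \<Rightarrow>
     ('x \<Rightarrow> real) \<Rightarrow> 'x \<Rightarrow> real" where
  "scatter_step \<mu> ev e G j f = (\<lambda>x. cmod (wavelet_conv \<mu> ev e G j f x))"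

text \<open>The head of the list is the scale that is applied first.\<close>

primrec scatter_path ::
    "'x measure \<Rightarrow> (nat \<Rightarrow> real) \<Rightarrow> (nat \<Rightarrow> 'x \<Rightarrow> complex) \<Rightarrow> (real \<Rightarrow> real) \<Rightarrow> int list \<Rightarrow>
     ('x \<Rightarrow> real) \<Rightarrow> 'x \<Rightarrow> real" where
  "scatter_path \<mu> ev e G [] f = f"
| "scatter_path \<mu> ev e G (j # js) f = scatter_path \<mu> ev e G js (scatter_step \<mu> ev e G j f)"

definition scattering ::
    "'x measure \<Rightarrow> (nat \<Rightarrow> real) \<Rightarrow> (nat \<Rightarrow> 'x \<Rightarrow> complex) \<Rightarrow> (real \<Rightarrow> real) \<Rightarrow>
     ('x \<Rightarrow> real) \<Rightarrow> int list \<Rightarrow> real" where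
  "scattering \<mu> ev e G f js = L2_norm \<mu> (scatter_path \<mu> ev e G js f)"

end

theory Submission
  imports Defs
begin

text \<open>By Bessel's inequality the coefficients of \<open>f * \<psi>\<^sub>j\<close> are square-summable, with sum over \<open>j\<close>
  telescoping to at most \<open>C\<^sup>2\<close> times the norm of \<open>f\<close> squared; Riesz--Fischer provides
  the functions \<open>f * \<psi>\<^sub>j\<close>.  Taking the modulus does not change norms, so iteration gives the
  factor \<open>C\<^sup>2\<^sup>m\<close>.

  The telescoping needs the eigenvalues to be nonnegative.  This follows from the maximum principle
  and so avoids integration by parts: at a point \<open>p\<close> where \<open>\<bar>e\<^sub>k\<bar>\<close> is maximal, the real function
  \<open>Re (cnj (e\<^sub>k p) * e\<^sub>k)\<close> is maximal too, hence its gradient vanishes and its Laplacian, the trace of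
  the positive definite inverse metric against the Hessian, is nonpositive.\<close>

section \<open>Nonnegativity of the eigenvalues\<close>

text \<open>If \<open>c\<close> were positive, \<open>h'\<close> would be positive just to the right
  of its zero at 0, and by the mean value theorem \<open>h\<close> would exceed \<open>h 0\<close>
  there.\<close>

lemma second_derivative_local_max:
  fixes h h' :: "real \<Rightarrow> real"
  assumes d: "d > 0" and h: "\<And>t. \<bar>t\<bar> < d \<Longrightarrow> (h has_real_derivative h' t) (at t)"
    and h': "(h' has_real_derivative c) (at 0)" and max: "\<And>t. \<bar>t\<bar> < d \<Longrightarrow> h t \<le> h 0"
  shows "h' 0 = 0" and "c \<le> 0"
proof -
  show h'0: "h' 0 = 0"
    by (rule DERIV_local_max[OF h d]) (use d max in auto)
  show "c \<le> 0"
  proof (rule ccontr)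
    assume "\<not> c \<le> 0"
    then obtain d' where d': "d' > 0" "\<And>t. 0 < t \<Longrightarrow> t < d' \<Longrightarrow> 0 < h' t"
      using DERIV_pos_inc_right[OF h'] h'0 by auto
    define s where "s = min d d' / 2"
    have s: "0 < s" "s < d" "s < d'" using d d' by (auto simp: s_def)
    obtain z where z: "0 < z" "z < s" "h s - h 0 = (s - 0) * h' z"
      using MVT2[of 0 s h h'] h s by auto
    have "0 < s * h' z" using d' z s by auto
    then show False using z max[of s] s by auto
  qed
qed

text \<open>Shifting the \<open>a\<close>-th coordinate turns the quadratic form into a polynomial
  of degree two in \<open>t\<close>; suitable choices of \<open>t\<close> drive the reduction
  below.\<close>

lemma quadratic_form_shift:
  fixes P :: "'n::finite \<Rightarrow> 'n \<Rightarrow> real"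
  assumes sym: "\<And>i j. P i j = P j i"
  shows "(\<Sum>i\<in>UNIV. \<Sum>j\<in>UNIV. (x i - (if i = a then t else 0)) * (x j - (if j = a then t else 0)) * P i j)
    = (\<Sum>i\<in>UNIV. \<Sum>j\<in>UNIV. x i * x j * P i j) - 2 * t * (\<Sum>j\<in>UNIV. x j * P a j) + t\<^sup>2 * P a a"
proof -
  have eq: "(x i - (if i = a then t else 0)) * (x j - (if j = a then t else 0)) * P i j
    = x i * x j * P i j - (if i = a then t * (x j * P i j) else 0) - (if j = a then t * (x i * P a i) else 0)
     + (if i = a then (if j = a then t\<^sup>2 * P i j else 0) else 0)" for i j
    using sym[of i a] by (simp add: algebra_simps power2_eq_square)
  have swap: "(\<Sum>i\<in>UNIV. \<Sum>j\<in>UNIV. if i = a then f i j else 0) = (\<Sum>j\<in>UNIV. f a j)" for f :: "'n \<Rightarrow> 'n \<Rightarrow> real"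
    by (subst sum.swap) simp
  show ?thesis
    unfolding eq by (simp add: sum.distrib sum_subtractf swap sum_distrib_left sum_negf mult.assoc)
qed

text \<open>Lagrange's reduction: splitting off one rank-one summand of \<open>P\<close> at a time avoids the spectral
  theorem.  Note that \<open>H\<close> need not be symmetric.\<close>

lemma sum_psd_nsd_nonpos:
  fixes P H :: "'n::finite \<Rightarrow> 'n \<Rightarrow> real"
  assumes H: "\<And>x. (\<Sum>i\<in>UNIV. \<Sum>j\<in>UNIV. x i * x j * H i j) \<le> 0"
    and sym: "\<And>i j. P i j = P j i"
    and psd: "\<And>x. 0 \<le> (\<Sum>i\<in>UNIV. \<Sum>j\<in>UNIV. x i * x j * P i j)"
  shows "(\<Sum>i\<in>UNIV. \<Sum>j\<in>UNIV. P i j * H i j) \<le> 0"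
proof -
  \<comment> \<open>Induction on a set \<open>S\<close> outside which the rows of \<open>P\<close>
    vanish, generalised over \<open>P\<close> because each step replaces it.\<close>
  have "(\<Sum>i\<in>UNIV. \<Sum>j\<in>UNIV. P i j * H i j) \<le> 0"
    if "finite S" "\<And>i j. i \<notin> S \<Longrightarrow> P i j = 0" "\<And>i j. P i j = P j i"
      "\<And>x. 0 \<le> (\<Sum>i\<in>UNIV. \<Sum>j\<in>UNIV. x i * x j * P i j)" for S and P :: "'n \<Rightarrow> 'n \<Rightarrow> real"
    using that
  proof (induction S arbitrary: P rule: finite_induct)
    case (insert a S)
    note sym = insert.prems(2) and psd = insert.prems(3)
    note shift = quadratic_form_shift[of P, OF sym]
    have shift_nonneg: "0 \<le> (\<Sum>i\<in>UNIV. \<Sum>j\<in>UNIV. x i * x j * P i j) - 2 * t * (\<Sum>j\<in>UNIV. x j * P a j) + t\<^sup>2 * P a a" for x t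
      using psd[of "\<lambda>i. x i - (if i = a then t else 0)"] unfolding shift .
    have "0 \<le> P a a" using shift_nonneg[of "\<lambda>_. 0" 1] by simp
    show ?case
    proof (cases "P a a = 0")
      case True
      \<comment> \<open>With a zero pivot the polynomial is affine in \<open>t\<close>. At the
        \<open>b\<close>-th unit vector, were \<open>P a b\<close> nonzero, the chosen
        \<open>t\<close> would give it the value -1.\<close>
      have row: "P a b = 0" for b
      proof (rule ccontr)
        assume n: "P a b \<noteq> 0"
        have delta: "(if i = b then 1 else 0) * c = (if i = b then c else 0)"
          "(\<Sum>j\<in>UNIV. if i = b then f j else 0) = (if i = b then \<Sum>j\<in>UNIV. f j else 0)" for i and c :: real and f :: "'n \<Rightarrow> real"
          by simp_all
        have e1: "(\<Sum>i\<in>UNIV. \<Sum>j\<in>UNIV. (if i = b then 1 else 0) * ((if j = b then 1 else 0) * P i j)) = P b b"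
          by (simp add: delta)
        have "0 \<le> P b b - 2 * ((P b b + 1) / (2 * P a b)) * P a b"
          using shift_nonneg[of "\<lambda>i. if i = b then 1 else 0" "(P b b + 1) / (2 * P a b)"] True
          unfolding mult.assoc e1 by (simp add: delta)
        then show False using n by (simp add: field_simps)
      qed
      show ?thesis
        by (rule insert.IH) (use insert.prems row in \<open>auto, metis\<close>)
    next
      case False
      with \<open>0 \<le> P a a\<close> have pos: "0 < P a a" by simp
      \<comment> \<open>Subtracting this rank-one matrix clears row and column \<open>a\<close> (a
        Schur complement), so the nonzero rows of \<open>Q\<close> lie in \<open>S\<close>.\<close>
      define Q where "Q i j = P i j - P a i * P a j / P a a" for i j
      have sq: "(\<Sum>i\<in>UNIV. \<Sum>j\<in>UNIV. x i * x j * (P a i * P a j)) = (\<Sum>j\<in>UNIV. x j * P a j)\<^sup>2" for x :: "'n \<Rightarrow> real"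
        unfolding power2_eq_square sum_product by (simp add: algebra_simps)
      have "(\<Sum>i\<in>UNIV. \<Sum>j\<in>UNIV. Q i j * H i j) \<le> 0"
      proof (rule insert.IH)
        show "Q i j = 0" if "i \<notin> S" for i j
          using that insert.prems(1)[of i] sym[of a i] pos by (cases "i = a") (auto simp: Q_def)
        show "Q i j = Q j i" for i j unfolding Q_def using sym[of i j] by simp
        show "0 \<le> (\<Sum>i\<in>UNIV. \<Sum>j\<in>UNIV. x i * x j * Q i j)" for x
        proof -
          let ?b = "\<Sum>j\<in>UNIV. x j * P a j"
          have "(\<Sum>i\<in>UNIV. \<Sum>j\<in>UNIV. x i * x j * Q i j)
            = (\<Sum>i\<in>UNIV. \<Sum>j\<in>UNIV. x i * x j * P i j) - (\<Sum>i\<in>UNIV. \<Sum>j\<in>UNIV. x i * x j * (P a i * P a j)) / P a a"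
            by (simp add: Q_def algebra_simps sum_subtractf sum_divide_distrib)
          \<comment> \<open>The shift \<open>t = ?b / P a a\<close> minimises the polynomial, and
            the minimum is the form of \<open>Q\<close> at \<open>x\<close>.\<close>
          also have "\<dots> = (\<Sum>i\<in>UNIV. \<Sum>j\<in>UNIV. x i * x j * P i j) - 2 * (?b / P a a) * ?b + (?b / P a a)\<^sup>2 * P a a"
            unfolding sq using pos by (simp add: field_simps power2_eq_square)
          also have "\<dots> \<ge> 0" by (rule shift_nonneg)
          finally show ?thesis .
        qed
      qed
      moreover have "(\<Sum>i\<in>UNIV. \<Sum>j\<in>UNIV. P i j * H i j)
        = (\<Sum>i\<in>UNIV. \<Sum>j\<in>UNIV. Q i j * H i j) + (\<Sum>i\<in>UNIV. \<Sum>j\<in>UNIV. P a i * P a j * H i j) / P a a"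
        by (simp add: Q_def algebra_simps sum_subtractf sum_divide_distrib)
      \<comment> \<open>The summand split off is the form of \<open>H\<close> at the row
        \<open>P a\<close>, divided by the positive pivot.\<close>
      moreover have "(\<Sum>i\<in>UNIV. \<Sum>j\<in>UNIV. P a i * P a j * H i j) / P a a \<le> 0"
        using H[of "P a"] pos by (simp add: divide_nonpos_pos)
      ultimately show ?thesis by linarith
    qed
  qed simp
  from this[of UNIV P] sym psd show ?thesis by simp
qed

section \<open>Inverses of positive definite matrices\<close>

lemma matrix_inv_inverse:
  fixes A :: "real^'n^'n"
  assumes "det A \<noteq> 0"
  shows "A ** matrix_inv A = mat 1" and "matrix_inv A ** A = mat 1"
proof -
  have "\<exists>B. A ** B = mat 1 \<and> B ** A = mat 1"
    using assms unfolding invertible_det_nz[symmetric] invertible_def by blast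
  then have "A ** matrix_inv A = mat 1 \<and> matrix_inv A ** A = mat 1"
    unfolding matrix_inv_def by (rule someI_ex)
  then show "A ** matrix_inv A = mat 1" and "matrix_inv A ** A = mat 1" by auto
qed

text \<open>Column \<open>j\<close> of the inverse solves a linear system with right-hand side
  \<open>axis j 1\<close>, so Cramer's rule applies. As quotients of determinants, the entries of
  the inverse metric will be seen to be differentiable.\<close>

lemma matrix_inv_entry_cramer:
  fixes A :: "real^'n^'n"
  assumes "det A \<noteq> 0"
  shows "matrix_inv A $ i $ j = det (\<chi> k l. if l = i then axis j 1 $ k else A $ k $ l) / det A"
proof -
  have "A *v (matrix_inv A *v axis j 1) = axis j 1"
    by (simp add: matrix_vector_mul_assoc matrix_inv_inverse[OF assms])
  then have "matrix_inv A *v axis j 1 = (\<chi> i. det (\<chi> k l. if l = i then axis j 1 $ k else A $ k $ l) / det A)"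
    using cramer[OF assms] by blast
  then have "(matrix_inv A *v axis j 1) $ i = det (\<chi> k l. if l = i then axis j 1 $ k else A $ k $ l) / det A"
    by simp
  then show ?thesis by (simp add: matrix_vector_mult_basis column_def)
qed

locale pd_matrix =
  fixes A :: "real^'n^'n"
  assumes sym: "transpose A = A" and pos: "\<And>v. v \<noteq> 0 \<Longrightarrow> v \<bullet> (A *v v) > 0"
begin

lemma det_nonzero: "det A \<noteq> 0"
proof -
  have "\<forall>v. A *v v = 0 \<longrightarrow> v = 0" using pos by force
  then have "\<exists>B. B ** A = mat 1" by (simp add: matrix_left_invertible_ker)
  then have "invertible A" unfolding invertible_def using matrix_left_right_inverse by blast
  then show ?thesis by (simp add: invertible_det_nz)
qed

lemma matrix_inv_sym: "matrix_inv A $ i $ j = matrix_inv A $ j $ i"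
proof -
  note inv = matrix_inv_inverse[OF det_nonzero]
  have "transpose (matrix_inv A) = transpose (matrix_inv A) ** (A ** matrix_inv A)"
    by (simp add: inv)
  also have "\<dots> = transpose (A ** matrix_inv A) ** matrix_inv A"
    by (simp only: matrix_transpose_mul sym matrix_mul_assoc)
  also have "\<dots> = matrix_inv A" by (simp add: inv transpose_mat)
  finally have "transpose (matrix_inv A) $ j $ i = matrix_inv A $ j $ i" by simp
  then show ?thesis by (simp add: transpose_def)
qed

text \<open>With \<open>w = matrix_inv A *v v\<close>, the form of the inverse at \<open>v\<close>
  equals the form of \<open>A\<close> at \<open>w\<close>.\<close>

lemma matrix_inv_psd: "0 \<le> (\<Sum>i\<in>UNIV. \<Sum>j\<in>UNIV. x i * x j * matrix_inv A $ i $ j)"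
proof -
  define v :: "real^'n" where "v = (\<chi> i. x i)"
  have "(\<Sum>i\<in>UNIV. \<Sum>j\<in>UNIV. x i * x j * matrix_inv A $ i $ j) = v \<bullet> (matrix_inv A *v v)"
    by (simp add: v_def inner_vec_def matrix_vector_mult_def sum_distrib_left algebra_simps)
  also have "\<dots> = (matrix_inv A *v v) \<bullet> (A *v (matrix_inv A *v v))"
    by (simp add: matrix_vector_mul_assoc matrix_inv_inverse[OF det_nonzero] inner_commute)
  also have "\<dots> \<ge> 0" using pos[of "matrix_inv A *v v"] by (cases "matrix_inv A *v v = 0") auto
  finally show ?thesis .
qed

end

section \<open>Differentiability of coordinate expressions\<close>

lemma smooth_on_imp_continuous_on: "smooth_on S f \<Longrightarrow> continuous_on S f"
  unfolding smooth_on_def by (metis Ck_on.simps(1))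

lemma smooth_on_imp_differentiable: "smooth_on S f \<Longrightarrow> x \<in> S \<Longrightarrow> f differentiable (at x)"
  unfolding smooth_on_def by (metis Ck_on.simps(2))

lemma smooth_on_frechet_derivative: "smooth_on S f \<Longrightarrow> smooth_on S (\<lambda>x. frechet_derivative f (at x) v)"
  unfolding smooth_on_def by (metis Ck_on.simps(2))

lemma frechet_derivative_eq_sum_partial_deriv:
  fixes f :: "real^'n::finite \<Rightarrow> 'b::real_normed_vector"
  assumes "f differentiable (at x)"
  shows "frechet_derivative f (at x) v = (\<Sum>i\<in>UNIV. v $ i *\<^sub>R partial_deriv i f x)"
proof -
  have lin: "linear (frechet_derivative f (at x))"
    by (rule linear_frechet_derivative[OF assms])
  have "frechet_derivative f (at x) v = frechet_derivative f (at x) (\<Sum>i\<in>UNIV. v $ i *\<^sub>R axis i 1)"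
    using basis_expansion[of v] by (simp add: scalar_mult_eq_scaleR)
  also have "\<dots> = (\<Sum>i\<in>UNIV. v $ i *\<^sub>R partial_deriv i f x)"
    by (simp add: linear_sum[OF lin] linear_scale[OF lin] partial_deriv_def)
  finally show ?thesis .
qed

lemma differentiable_prod:
  fixes f :: "'i \<Rightarrow> 'a::real_normed_vector \<Rightarrow> real"
  assumes "\<And>i. i \<in> A \<Longrightarrow> f i differentiable (at x)"
  shows "(\<lambda>y. \<Prod>i\<in>A. f i y) differentiable (at x)"
  using assms by (induction A rule: infinite_finite_induct) (auto intro: differentiable_mult)

lemma differentiable_det:
  fixes A :: "'a::real_normed_vector \<Rightarrow> real^'n^'n"
  assumes "\<And>i j. (\<lambda>y. A y $ i $ j) differentiable (at x)"
  shows "(\<lambda>y. det (A y)) differentiable (at x)"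
  unfolding det_def
  by (intro differentiable_sum ballI differentiable_mult differentiable_const differentiable_prod assms)
    (simp add: finite_permutations)

text \<open>\<open>sqrt\<close> is extended to negative arguments as an odd function, hence is
  differentiable everywhere except at 0; a nonvanishing determinant is therefore enough for the
  volume density.\<close>

lemma differentiable_sqrt:
  fixes f :: "'a::real_normed_vector \<Rightarrow> real"
  assumes "f differentiable (at x)" and "f x \<noteq> 0"
  shows "(\<lambda>y. sqrt (f y)) differentiable (at x)"
proof -
  have "sqrt differentiable (at (f x))"
    using DERIV_real_sqrt_generic[OF assms(2), of "if f x > 0 then inverse (sqrt (f x)) / 2 else - inverse (sqrt (f x)) / 2"]
    unfolding real_differentiable_def by (intro exI) simp
  then show ?thesis
    using differentiable_chain_at[OF assms(1)] by (simp add: o_def)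
qed

section \<open>Metric and Laplacian in a chart\<close>

locale chart =
  fixes M :: "(real^'d::finite) set" and g :: "real^'d \<Rightarrow> real^'d \<Rightarrow> real^'d \<Rightarrow> real"
    and U :: "(real^'n::finite) set" and \<phi> :: "real^'n \<Rightarrow> real^'d"
  assumes metric: "riemannian_metric TYPE('n) M g" and param: "local_param M U \<phi>"
begin

lemma open_U: "open U" and smooth_param: "smooth_on U \<phi>"
  and inj_derivative: "x \<in> U \<Longrightarrow> inj (frechet_derivative \<phi> (at x))"
  and openin_image: "openin (top_of_set M) (\<phi> ` U)"
  and homeo: "\<exists>\<psi>. homeomorphism U (\<phi> ` U) \<phi> \<psi>"
  using param by (auto simp: local_param_def)

lemma param_in_M: "x \<in> U \<Longrightarrow> \<phi> x \<in> M"
  using openin_image openin_imp_subset by fastforce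

text \<open>The matrix is the Gram matrix, in the standard basis, of the metric pulled back along
  the derivative of \<phi>. The derivative is injective, so nonzero vectors go to nonzero tangent
  vectors, on which the metric is positive.\<close>

lemma pd_metric_matrix:
  assumes x: "x \<in> U"
  shows "pd_matrix (metric_matrix g \<phi> x)"
proof -
  define D where "D = frechet_derivative \<phi> (at x)"
  define b where "b v w = g (\<phi> x) (D v) (D w)" for v w
  have D: "linear D" unfolding D_def
    by (intro linear_frechet_derivative smooth_on_imp_differentiable[OF smooth_param] x)
  have tangent: "D v \<in> tangent_space TYPE('n) M (\<phi> x)" for v
    unfolding tangent_space_def D_def using param x by blast
  note p = param_in_M[OF x]
  have comb: "g (\<phi> x) (s *\<^sub>R D u + t *\<^sub>R D v) (D w) = s * b u w + t * b v w" for s t u v w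
    using metric p tangent unfolding riemannian_metric_def b_def by blast
  have b_sym: "b u v = b v u" for u v
    using metric p tangent unfolding riemannian_metric_def b_def by blast
  \<comment> \<open>Coefficients 1 and 1 in \<open>comb\<close> give additivity; second coefficient
    0 gives homogeneity.\<close>
  have b_lin: "linear (\<lambda>v. b v w)" for w
    using comb[of 1 _ 1] comb[of _ _ 0]
    by (intro linearI) (simp_all add: b_def linear_add[OF D] linear_scale[OF D])
  have b_expand: "b v w = (\<Sum>i\<in>UNIV. v $ i * b (axis i 1) w)" for v w
  proof -
    have "b v w = b (\<Sum>i\<in>UNIV. v $ i *\<^sub>R axis i 1) w"
      using basis_expansion[of v] by (simp add: scalar_mult_eq_scaleR)
    then show ?thesis by (simp add: linear_sum[OF b_lin] linear_scale[OF b_lin])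
  qed
  have entry: "metric_matrix g \<phi> x $ i $ j = b (axis i 1) (axis j 1)" for i j
    by (simp add: metric_matrix_def b_def D_def partial_deriv_def)
  show ?thesis
  proof
    show "transpose (metric_matrix g \<phi> x) = metric_matrix g \<phi> x"
      by (simp add: vec_eq_iff transpose_def entry b_sym)
    fix v :: "real^'n" assume "v \<noteq> 0"
    have "v \<bullet> (metric_matrix g \<phi> x *v v) = (\<Sum>i\<in>UNIV. v $ i * (\<Sum>j\<in>UNIV. v $ j * b (axis j 1) (axis i 1)))"
      by (simp add: inner_vec_def matrix_vector_mult_def entry b_sym mult.commute)
    also have "\<dots> = (\<Sum>i\<in>UNIV. v $ i * b (axis i 1) v)"
      by (intro sum.cong refl arg_cong2[where f = "(*)"]) (metis b_expand b_sym)
    also have "\<dots> = b v v" by (rule b_expand[symmetric])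
    also have "b v v > 0"
    proof -
      have "D v \<noteq> D 0" using inj_derivative[OF x] \<open>v \<noteq> 0\<close> unfolding D_def by (metis injD)
      then have "D v \<noteq> 0" by (simp add: linear_0[OF D])
      then show ?thesis
        using metric p tangent unfolding riemannian_metric_def b_def by blast
    qed
    finally show "v \<bullet> (metric_matrix g \<phi> x *v v) > 0" .
  qed
qed

lemma differentiable_metric_matrix:
  "x \<in> U \<Longrightarrow> (\<lambda>y. metric_matrix g \<phi> y $ i $ j) differentiable (at x)"
  using metric param unfolding riemannian_metric_def by (blast intro: smooth_on_imp_differentiable)

lemma volume_density_nonzero: "x \<in> U \<Longrightarrow> volume_density g \<phi> x \<noteq> 0"
  using pd_matrix.det_nonzero[OF pd_metric_matrix] by (simp add: volume_density_def)

lemma differentiable_volume_density: "x \<in> U \<Longrightarrow> volume_density g \<phi> differentiable (at x)"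
  unfolding volume_density_def[abs_def]
  by (intro differentiable_sqrt differentiable_det differentiable_metric_matrix
      pd_matrix.det_nonzero pd_metric_matrix)

text \<open>Cramer's formula holds on all of the open set \<open>U\<close>, where the determinant
  does not vanish, so its derivative at \<open>x\<close> is that of the inverse.\<close>

lemma differentiable_metric_matrix_inv:
  assumes x: "x \<in> U"
  shows "(\<lambda>y. matrix_inv (metric_matrix g \<phi> y) $ i $ j) differentiable (at x)"
proof -
  let ?c = "\<lambda>y. det (\<chi> k l. if l = i then axis j 1 $ k else metric_matrix g \<phi> y $ k $ l)
      / det (metric_matrix g \<phi> y)"
  have "(\<lambda>y. if l = i then axis j 1 $ k else metric_matrix g \<phi> y $ k $ l) differentiable (at x)" for k l
    using x by (cases "l = i") (auto intro: differentiable_metric_matrix)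
  then have "?c differentiable (at x)"
    by (intro differentiable_divide differentiable_det)
      (use x pd_matrix.det_nonzero[OF pd_metric_matrix[OF x]] in \<open>auto intro: differentiable_metric_matrix\<close>)
  then obtain c' where "(?c has_derivative c') (at x)" by (auto simp: differentiable_def)
  then have "((\<lambda>y. matrix_inv (metric_matrix g \<phi> y) $ i $ j) has_derivative c') (at x)"
    by (rule has_derivative_transform_within_open[OF _ open_U x])
      (simp add: matrix_inv_entry_cramer pd_matrix.det_nonzero pd_metric_matrix)
  then show ?thesis by (auto simp: differentiable_def)
qed

text \<open>At a maximum of \<open>L\<close> composed with \<open>f\<close> in the chart, the first
  derivatives vanish and the Hessian is negative semidefinite, which leaves only the trace of the
  inverse metric against the Hessian. The functional \<open>L\<close> reduces vector-valued
  \<open>f\<close> to the real case.\<close>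

lemma laplacian_coord_at_maximum:
  fixes f :: "real^'d \<Rightarrow> 'b::real_normed_vector" and L :: "'b \<Rightarrow> real"
  assumes L: "bounded_linear L" and f: "smooth_on U (\<lambda>y. f (\<phi> y))" and x: "x \<in> U"
    and max: "\<And>y. y \<in> U \<Longrightarrow> L (f (\<phi> y)) \<le> L (f (\<phi> x))"
  shows "L (laplacian_coord g \<phi> f x) \<le> 0"
proof -
  define u where "u y = f (\<phi> y)" for y
  have smooth_u: "smooth_on U u" using f by (simp add: u_def[abs_def])
  have du: "u differentiable (at y)" if "y \<in> U" for y
    by (rule smooth_on_imp_differentiable[OF smooth_u that])
  have dpu: "partial_deriv j u differentiable (at y)" if "y \<in> U" for y j
    unfolding partial_deriv_def[abs_def]
    by (rule smooth_on_imp_differentiable[OF smooth_on_frechet_derivative[OF smooth_u] that])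
  interpret L: bounded_linear L by (rule L)
  define H where "H i j = L (partial_deriv i (partial_deriv j u) x)" for i j
  obtain r where r: "r > 0" "ball x r \<subseteq> U"
    using open_U x by (meson open_contains_ball)
  have line: "(\<Sum>j\<in>UNIV. v $ j * L (partial_deriv j u x)) = 0 \<and>
      (\<Sum>i\<in>UNIV. \<Sum>j\<in>UNIV. v $ i * v $ j * H i j) \<le> 0" for v :: "real^'n"
  proof -
    \<comment> \<open>Keeps the segment inside the ball around \<open>x\<close>; the added 1 covers
      \<open>v = 0\<close>.\<close>
    define d where "d = r / (norm v + 1)"
    have nv: "norm v + 1 > 0" using norm_ge_zero[of v] by linarith
    have "d > 0" using r nv by (simp add: d_def)
    have inU: "x + t *\<^sub>R v \<in> U" if "\<bar>t\<bar> < d" for t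
    proof -
      have "\<bar>t\<bar> * norm v \<le> \<bar>t\<bar> * (norm v + 1)" by (intro mult_left_mono) auto
      also have "\<dots> < r" using that nv by (simp add: d_def field_simps)
      finally show ?thesis using r(2) by (auto simp: dist_norm subset_eq)
    qed
    define h where "h t = L (u (x + t *\<^sub>R v))" for t
    define h' where "h' t = (\<Sum>j\<in>UNIV. v $ j * L (partial_deriv j u (x + t *\<^sub>R v)))" for t
    \<comment> \<open>Chain rule along the line for general \<open>w\<close>, since it is applied to
      \<open>u\<close> and then to each \<open>partial_deriv j u\<close>.\<close>
    have along: "((\<lambda>t. L (w (x + t *\<^sub>R v))) has_real_derivative
        (\<Sum>i\<in>UNIV. v $ i * L (partial_deriv i w (x + t *\<^sub>R v)))) (at t)"
      if w: "w differentiable (at (x + t *\<^sub>R v))" for w :: "real^'n \<Rightarrow> 'b" and t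
    proof -
      have 1: "(w has_derivative frechet_derivative w (at (x + t *\<^sub>R v))) (at (x + t *\<^sub>R v))"
        using w by (simp add: frechet_derivative_works)
      have 2: "((\<lambda>t. x + t *\<^sub>R v) has_derivative (\<lambda>s. s *\<^sub>R v)) (at t)"
        by (auto intro!: derivative_eq_intros)
      have lin: "linear (frechet_derivative w (at (x + t *\<^sub>R v)))"
        by (rule linear_frechet_derivative[OF w])
      have "((\<lambda>t. L (w (x + t *\<^sub>R v))) has_derivative (\<lambda>s. L (frechet_derivative w (at (x + t *\<^sub>R v)) (s *\<^sub>R v)))) (at t)"
        using L.has_derivative[OF diff_chain_at[OF 2 1]] by (simp add: o_def)
      moreover have "L (frechet_derivative w (at (x + t *\<^sub>R v)) (s *\<^sub>R v))
          = (\<Sum>i\<in>UNIV. v $ i * L (partial_deriv i w (x + t *\<^sub>R v))) * s" for s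
        by (simp add: linear_scale[OF lin] L.scaleR frechet_derivative_eq_sum_partial_deriv[OF w] L.sum sum_distrib_left mult_ac)
      ultimately show ?thesis by (simp add: has_field_derivative_def)
    qed
    have 1: "(h has_real_derivative h' t) (at t)" if "\<bar>t\<bar> < d" for t
      unfolding h_def h'_def by (rule along[OF du[OF inU[OF that]]])
    have "((\<lambda>t. \<Sum>j\<in>UNIV. v $ j * L (partial_deriv j u (x + t *\<^sub>R v))) has_real_derivative
        (\<Sum>j\<in>UNIV. v $ j * (\<Sum>i\<in>UNIV. v $ i * L (partial_deriv i (partial_deriv j u) (x + 0 *\<^sub>R v))))) (at 0)"
      by (intro DERIV_sum DERIV_cmult along dpu inU) (use \<open>d > 0\<close> in simp)
    then have 2: "(h' has_real_derivative (\<Sum>j\<in>UNIV. v $ j * (\<Sum>i\<in>UNIV. v $ i * H i j))) (at 0)"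
      unfolding h'_def[abs_def] H_def by simp
    have 3: "h t \<le> h 0" if "\<bar>t\<bar> < d" for t
      using max[OF inU[OF that]] by (simp add: h_def u_def)
    have "(\<Sum>j\<in>UNIV. v $ j * (\<Sum>i\<in>UNIV. v $ i * H i j)) = (\<Sum>i\<in>UNIV. \<Sum>j\<in>UNIV. v $ i * v $ j * H i j)"
      by (subst sum.swap) (simp add: sum_distrib_left algebra_simps)
    with second_derivative_local_max[OF \<open>d > 0\<close> 1 2 3] show ?thesis
      by (simp add: h'_def)
  qed
  have crit: "L (partial_deriv j u x) = 0" for j
  proof -
    have "axis j 1 $ k * c = (if k = j then c else 0)" for k and c :: real
      by (simp add: axis_def)
    then show ?thesis using line[of "axis j 1"] by simp
  qed
  have H_nsd: "(\<Sum>i\<in>UNIV. \<Sum>j\<in>UNIV. y i * y j * H i j) \<le> 0" for y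
    using line[of "\<chi> i. y i"] by simp
  define a where "a i j y = volume_density g \<phi> y * matrix_inv (metric_matrix g \<phi> y) $ i $ j" for i j y
  have da: "a i j differentiable (at x)" for i j
    unfolding a_def[abs_def]
    by (intro differentiable_mult differentiable_volume_density differentiable_metric_matrix_inv x)
  \<comment> \<open>The product rule also produces derivatives of the coefficients
    \<open>a i j\<close>, but these multiply first derivatives of \<open>u\<close>, which
    \<open>L\<close> sends to 0 by \<open>crit\<close>.\<close>
  have flux: "L (partial_deriv i (\<lambda>y. volume_density g \<phi> y *\<^sub>R
      (\<Sum>j\<in>UNIV. matrix_inv (metric_matrix g \<phi> y) $ i $ j *\<^sub>R partial_deriv j u y)) x)
    = (\<Sum>j\<in>UNIV. a i j x * H i j)" for i
  proof -
    have "((\<lambda>y. \<Sum>j\<in>UNIV. a i j y *\<^sub>R partial_deriv j u y) has_derivative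
      (\<lambda>v. \<Sum>j\<in>UNIV. a i j x *\<^sub>R frechet_derivative (partial_deriv j u) (at x) v
        + frechet_derivative (a i j) (at x) v *\<^sub>R partial_deriv j u x)) (at x)"
      using da dpu[OF x] by (intro has_derivative_sum has_derivative_scaleR) (auto simp: frechet_derivative_works)
    from fun_cong[OF frechet_derivative_at[OF this], of "axis i 1"]
    have "partial_deriv i (\<lambda>y. \<Sum>j\<in>UNIV. a i j y *\<^sub>R partial_deriv j u y) x
      = (\<Sum>j\<in>UNIV. a i j x *\<^sub>R partial_deriv i (partial_deriv j u) x + partial_deriv i (a i j) x *\<^sub>R partial_deriv j u x)"
      by (simp add: partial_deriv_def)
    then show ?thesis
      by (simp add: a_def scaleR_sum_right L.sum L.add L.scaleR crit H_def)
  qed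
  have "L (laplacian_coord g \<phi> f x) = (1 / volume_density g \<phi> x) * (\<Sum>i\<in>UNIV. \<Sum>j\<in>UNIV. a i j x * H i j)"
    unfolding laplacian_coord_def L.scaleR L.sum flux[symmetric] by (simp add: u_def[abs_def])
  also have "\<dots> = (\<Sum>i\<in>UNIV. \<Sum>j\<in>UNIV. matrix_inv (metric_matrix g \<phi> x) $ i $ j * H i j)"
    using volume_density_nonzero[OF x] by (simp add: a_def sum_distrib_left)
  also have "\<dots> \<le> 0"
  proof -
    interpret pd_matrix "metric_matrix g \<phi> x" by (rule pd_metric_matrix[OF x])
    show ?thesis by (rule sum_psd_nsd_nonpos[OF H_nsd matrix_inv_sym matrix_inv_psd])
  qed
  finally show ?thesis .
qed

text \<open>On the image of the chart, \<open>f\<close> is the smooth coordinate expression composed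
  with the inverse of \<phi>. The image is relatively open, so continuity within it is continuity
  within \<open>M\<close>.\<close>

lemma continuous_at_chart_point:
  assumes f: "smooth_on U (\<lambda>y. f (\<phi> y))" and x: "x \<in> U"
  shows "continuous (at (\<phi> x) within M) f"
proof -
  obtain \<psi> where \<psi>: "homeomorphism U (\<phi> ` U) \<phi> \<psi>" using homeo by blast
  have "continuous_on (\<phi> ` U) (\<lambda>p. f (\<phi> (\<psi> p)))"
    using \<psi> by (intro continuous_on_compose2[OF smooth_on_imp_continuous_on[OF f]])
      (auto simp: homeomorphism_def)
  then have "continuous_on (\<phi> ` U) f"
    by (rule continuous_on_eq) (use \<psi> in \<open>auto simp: homeomorphism_def\<close>)
  then have c: "continuous (at (\<phi> x) within \<phi> ` U) f"
    using x by (simp add: continuous_on_eq_continuous_within)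
  obtain T where T: "open T" "\<phi> ` U = M \<inter> T"
    using openin_image by (auto simp: openin_open)
  have "at (\<phi> x) within \<phi> ` U = at (\<phi> x) within M"
    by (rule at_within_nhd[OF _ T(1)]) (use T x in auto)
  with c show ?thesis by simp
qed

end

section \<open>Maximum principle for eigenfunctions\<close>

text \<open>At a maximum \<open>p\<close> of the modulus, which exists by compactness, a suitable
  functional sends the Laplacian to \<open>- \<kappa> * (cmod (f p))\<^sup>2\<close>. This is
  nonpositive by the maximum principle, and \<open>f p\<close> is nonzero because \<open>f q\<close>
  is.\<close>

lemma eigenvalue_nonneg:
  fixes M :: "(real^'d::finite) set" and f :: "real^'d \<Rightarrow> complex"
  assumes M: "compact M" "smooth_submanifold TYPE('n::finite) M"
    and g: "riemannian_metric TYPE('n) M g"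
    and f: "smooth_function TYPE('n) M f"
    and eigen: "\<And>p. p \<in> M \<Longrightarrow> - laplace_beltrami TYPE('n) M g f p = \<kappa> *\<^sub>R f p"
    and q: "q \<in> M" "f q \<noteq> 0"
  shows "\<kappa> \<ge> 0"
proof -
  have chart: "chart M g U \<phi>" if "local_param M U \<phi>" for U :: "(real^'n) set" and \<phi>
    by (rule chart.intro[OF g that])
  have smooth: "smooth_on U (\<lambda>y. f (\<phi> y))" if "local_param M U \<phi>" for U :: "(real^'n) set" and \<phi>
    using f that unfolding smooth_function_def by blast
  have "continuous_on M f"
    unfolding continuous_on_eq_continuous_within
  proof
    fix p assume "p \<in> M"
    then obtain U :: "(real^'n) set" and \<phi> x where U: "local_param M U \<phi>" and x: "x \<in> U" "p = \<phi> x"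
      using M(2) unfolding smooth_submanifold_def by blast
    show "continuous (at p within M) f"
      unfolding x(2) by (rule chart.continuous_at_chart_point[OF chart[OF U] smooth[OF U] x(1)])
  qed
  then have "continuous_on M (\<lambda>p. cmod (f p))" by (intro continuous_intros)
  then obtain p where p: "p \<in> M" "\<And>y. y \<in> M \<Longrightarrow> cmod (f y) \<le> cmod (f p)"
    using continuous_attains_sup[of M "\<lambda>p. cmod (f p)"] M(1) q by blast
  then have fp: "f p \<noteq> 0" using q by fastforce
  \<comment> \<open>\<open>laplace_beltrami\<close> chooses among the values computed in charts
    around \<open>p\<close>; the argument runs in a chart that realises the choice.\<close>
  obtain U :: "(real^'n) set" and \<phi> x where
    ch: "local_param M U \<phi>" "x \<in> U" "\<phi> x = p" "laplace_beltrami TYPE('n) M g f p = laplacian_coord g \<phi> f x"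
  proof -
    obtain U :: "(real^'n) set" and \<phi> x where "local_param M U \<phi>" "x \<in> U" "p = \<phi> x"
      using M(2) p(1) unfolding smooth_submanifold_def by blast
    then have "\<exists>y. \<exists>(U :: (real^'n) set) \<phi> x. local_param M U \<phi> \<and> x \<in> U \<and> \<phi> x = p \<and> y = laplacian_coord g \<phi> f x"
      by blast
    from someI_ex[OF this] show ?thesis
      unfolding laplace_beltrami_def[of "TYPE('n)" M g f p, symmetric] using that by blast
  qed
  \<comment> \<open>The functional of norm \<open>\<bar>f p\<bar>\<close> that is aligned with \<open>f p\<close>; so \<open>L \<circ> f\<close> is maximal at \<open>p\<close> as well.\<close>
  define L where "L z = Re (cnj (f p) * z)" for z
  have L: "bounded_linear L" unfolding L_def[abs_def]
    by (rule bounded_linear_compose[OF bounded_linear_Re bounded_linear_mult_right])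
  have Lp: "L (f p) = (cmod (f p))\<^sup>2" unfolding L_def cmod_power2 by (simp add: power2_eq_square)
  interpret chart M g U \<phi> by (rule chart[OF ch(1)])
  have "L (laplacian_coord g \<phi> f x) \<le> 0"
  proof (rule laplacian_coord_at_maximum[OF L smooth[OF ch(1)] ch(2)])
    fix y assume "y \<in> U"
    have "L (f (\<phi> y)) \<le> cmod (f p) * cmod (f (\<phi> y))"
      unfolding L_def using complex_Re_le_cmod[of "cnj (f p) * f (\<phi> y)"] by (simp add: norm_mult)
    also have "\<dots> \<le> cmod (f p) * cmod (f p)"
      by (intro mult_left_mono p(2) param_in_M \<open>y \<in> U\<close>) simp
    finally show "L (f (\<phi> y)) \<le> L (f (\<phi> x))" using ch(3) Lp by (simp add: power2_eq_square)
  qed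
  moreover have "laplacian_coord g \<phi> f x = (- \<kappa>) *\<^sub>R f p"
    using eigen[OF p(1)] ch(4) by (metis minus_minus scaleR_minus_left)
  ultimately have "- \<kappa> * (cmod (f p))\<^sup>2 \<le> 0"
    using linear_scale[OF bounded_linear.linear[OF L], of "- \<kappa>" "f p"] Lp by simp
  then show ?thesis using fp by (simp add: zero_le_mult_iff)
qed

section \<open>Bessel's inequality and the Riesz--Fischer theorem\<close>

lemma square_integrable_of_real:
  "square_integrable \<mu> (f :: 'x \<Rightarrow> real) \<Longrightarrow> square_integrable \<mu> (\<lambda>x. complex_of_real (f x))"
  by (auto simp: square_integrable_def)

lemma square_integrable_add:
  fixes f g :: "'x \<Rightarrow> 'b::{real_normed_vector, second_countable_topology}"
  assumes f: "square_integrable \<mu> f" and g: "square_integrable \<mu> g"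
  shows "square_integrable \<mu> (\<lambda>x. f x + g x)"
  unfolding square_integrable_def
proof
  show m: "(\<lambda>x. f x + g x) \<in> borel_measurable \<mu>"
    using f g by (auto simp: square_integrable_def)
  show "integrable \<mu> (\<lambda>x. (norm (f x + g x))\<^sup>2)"
  proof (rule Bochner_Integration.integrable_bound)
    show "integrable \<mu> (\<lambda>x. 2 * (norm (f x))\<^sup>2 + 2 * (norm (g x))\<^sup>2)"
      using f g by (auto simp: square_integrable_def)
    show "AE x in \<mu>. norm ((norm (f x + g x))\<^sup>2) \<le> norm (2 * (norm (f x))\<^sup>2 + 2 * (norm (g x))\<^sup>2)"
    proof (rule AE_I2)
      fix x
      have "(norm (f x + g x))\<^sup>2 \<le> (norm (f x) + norm (g x))\<^sup>2"
        by (intro power_mono norm_triangle_ineq) auto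
      also have "\<dots> \<le> 2 * (norm (f x))\<^sup>2 + 2 * (norm (g x))\<^sup>2"
        using zero_le_power2[of "norm (f x) - norm (g x)"]
        by (simp add: power2_eq_square algebra_simps)
      finally show "norm ((norm (f x + g x))\<^sup>2) \<le> norm (2 * (norm (f x))\<^sup>2 + 2 * (norm (g x))\<^sup>2)"
        by simp
    qed
  qed (use m in measurable)
qed

lemma square_integrable_mult_const:
  fixes f :: "'x \<Rightarrow> complex"
  assumes "square_integrable \<mu> f"
  shows "square_integrable \<mu> (\<lambda>x. c * f x)"
  using assms by (auto simp: square_integrable_def norm_mult power_mult_distrib)

lemma square_integrable_diff:
  fixes f g :: "'x \<Rightarrow> complex"
  assumes "square_integrable \<mu> f" "square_integrable \<mu> g"
  shows "square_integrable \<mu> (\<lambda>x. f x - g x)"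
  using square_integrable_add[OF assms(1) square_integrable_mult_const[OF assms(2), of "-1"]]
  by simp

lemma square_integrable_sum:
  fixes f :: "'i \<Rightarrow> 'x \<Rightarrow> complex"
  assumes "\<And>i. i \<in> A \<Longrightarrow> square_integrable \<mu> (f i)"
  shows "square_integrable \<mu> (\<lambda>x. \<Sum>i\<in>A. f i x)"
  using assms
proof (induction A rule: infinite_finite_induct)
  case (insert i A)
  then show ?case using square_integrable_add[of \<mu> "f i" "\<lambda>x. \<Sum>i\<in>A. f i x"] by simp
qed (auto simp: square_integrable_def)

lemma square_integrable_integrable_mult_cnj:
  assumes f: "square_integrable \<mu> f" and g: "square_integrable \<mu> g"
  shows "integrable \<mu> (\<lambda>x. f x * cnj (g x))"
proof (rule Bochner_Integration.integrable_bound)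
  show "integrable \<mu> (\<lambda>x. (norm (f x))\<^sup>2 + (norm (g x))\<^sup>2)"
    using f g by (auto simp: square_integrable_def)
  have [measurable]: "f \<in> borel_measurable \<mu>" "g \<in> borel_measurable \<mu>"
    using f g by (auto simp: square_integrable_def)
  have "(\<lambda>x. cnj (g x)) \<in> borel_measurable \<mu>"
    by (rule borel_measurable_continuous_on[where f = cnj]) (auto intro!: continuous_intros)
  then show "(\<lambda>x. f x * cnj (g x)) \<in> borel_measurable \<mu>"
    by measurable
  show "AE x in \<mu>. norm (f x * cnj (g x)) \<le> norm ((norm (f x))\<^sup>2 + (norm (g x))\<^sup>2)"
  proof (rule AE_I2)
    fix x
    have "2 * (norm (f x) * norm (g x)) \<le> (norm (f x))\<^sup>2 + (norm (g x))\<^sup>2"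
      using zero_le_power2[of "norm (f x) - norm (g x)"]
      by (simp add: power2_eq_square algebra_simps)
    moreover have "0 \<le> norm (f x) * norm (g x)" by simp
    ultimately show "norm (f x * cnj (g x)) \<le> norm ((norm (f x))\<^sup>2 + (norm (g x))\<^sup>2)"
      unfolding norm_mult complex_mod_cnj real_norm_def by linarith
  qed
qed

lemma integral_norm_square_complex:
  fixes f :: "'x \<Rightarrow> complex"
  shows "complex_of_real (\<integral>x. (norm (f x))\<^sup>2 \<partial>\<mu>) = (\<integral>x. f x * cnj (f x) \<partial>\<mu>)"
  by (simp add: complex_norm_square[symmetric] flip: integral_complex_of_real)

lemma L2_norm_square: "(L2_norm \<mu> f)\<^sup>2 = (\<integral>x. (norm (f x))\<^sup>2 \<partial>\<mu>)"
  by (simp add: L2_norm_def)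

section \<open>Finite orthonormal expansions\<close>

definition L2_orthonormal :: "'x measure \<Rightarrow> (nat \<Rightarrow> 'x \<Rightarrow> complex) \<Rightarrow> bool" where
  "L2_orthonormal \<mu> e \<longleftrightarrow> (\<forall>k. square_integrable \<mu> (e k)) \<and>
     (\<forall>k l. (\<integral>x. e k x * cnj (e l x) \<partial>\<mu>) = (if k = l then 1 else 0))"

lemma L2_orthonormal_basis_imp: "L2_orthonormal_basis \<mu> e \<Longrightarrow> L2_orthonormal \<mu> e"
  by (simp add: L2_orthonormal_basis_def L2_orthonormal_def)

lemma square_integrable_orthonormal_sum:
  assumes "L2_orthonormal \<mu> e"
  shows "square_integrable \<mu> (\<lambda>x. \<Sum>k\<in>A. c k * e k x)"
  using assms by (auto simp: L2_orthonormal_def intro!: square_integrable_sum square_integrable_mult_const)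

lemma integral_orthonormal_sum:
  assumes e: "L2_orthonormal \<mu> e" and f: "square_integrable \<mu> f" and A: "finite A"
  shows "(\<integral>x. f x * cnj (\<Sum>k\<in>A. c k * e k x) \<partial>\<mu>) = (\<Sum>k\<in>A. cnj (c k) * (\<integral>x. f x * cnj (e k x) \<partial>\<mu>))"
proof -
  have i: "integrable \<mu> (\<lambda>x. f x * cnj (e k x))" for k
    using e f by (auto simp: L2_orthonormal_def intro: square_integrable_integrable_mult_cnj)
  have "(\<integral>x. f x * cnj (\<Sum>k\<in>A. c k * e k x) \<partial>\<mu>) = (\<integral>x. (\<Sum>k\<in>A. cnj (c k) * (f x * cnj (e k x))) \<partial>\<mu>)"
    by (simp add: sum_distrib_left algebra_simps)
  also have "\<dots> = (\<Sum>k\<in>A. \<integral>x. cnj (c k) * (f x * cnj (e k x)) \<partial>\<mu>)"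
    by (rule Bochner_Integration.integral_sum) (use i in auto)
  also have "\<dots> = (\<Sum>k\<in>A. cnj (c k) * (\<integral>x. f x * cnj (e k x) \<partial>\<mu>))"
    by simp
  finally show ?thesis .
qed

text \<open>Pythagoras: pairing the sum with \<open>e l\<close> returns \<open>c l\<close>, and the
  norm is the pairing of the sum with itself.\<close>

lemma L2_norm_orthonormal_sum:
  assumes e: "L2_orthonormal \<mu> e" and A: "finite A"
  shows "(L2_norm \<mu> (\<lambda>x. \<Sum>k\<in>A. c k * e k x))\<^sup>2 = (\<Sum>k\<in>A. (cmod (c k))\<^sup>2)"
proof -
  let ?S = "\<lambda>x. \<Sum>k\<in>A. c k * e k x"
  have sq: "square_integrable \<mu> (e k)" for k using e by (auto simp: L2_orthonormal_def)
  have "(\<integral>x. ?S x * cnj (e l x) \<partial>\<mu>) = c l" if "l \<in> A" for l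
  proof -
    have "(\<integral>x. ?S x * cnj (e l x) \<partial>\<mu>) = (\<Sum>k\<in>A. \<integral>x. c k * (e k x * cnj (e l x)) \<partial>\<mu>)"
      unfolding sum_distrib_right mult.assoc
      by (rule Bochner_Integration.integral_sum)
        (auto intro!: square_integrable_integrable_mult_cnj sq)
    also have "\<dots> = (\<Sum>k\<in>A. c k * (if k = l then 1 else 0))"
      using e by (simp add: L2_orthonormal_def)
    also have "\<dots> = c l" using that A by (simp add: if_distrib cong: if_cong)
    finally show ?thesis .
  qed
  then have "(\<integral>x. ?S x * cnj (?S x) \<partial>\<mu>) = (\<Sum>k\<in>A. cnj (c k) * c k)"
    using integral_orthonormal_sum[OF e square_integrable_orthonormal_sum[OF e] A, of c A c] by simp
  also have "\<dots> = complex_of_real (\<Sum>k\<in>A. (cmod (c k))\<^sup>2)"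
    unfolding of_real_sum complex_norm_square by (simp add: mult.commute)
  finally show ?thesis
    unfolding integral_norm_square_complex[symmetric] L2_norm_square of_real_eq_iff .
qed

text \<open>Let \<open>?S\<close> be the projection of \<open>f\<close> to the span of the
  \<open>e k\<close> with \<open>k\<close> in \<open>A\<close>. Both mixed products and the square
  of \<open>?S\<close> equal \<open>?s\<close>, so the squared norm of \<open>f - ?S\<close>, which
  is nonnegative, is that of \<open>f\<close> minus \<open>?s\<close>.\<close>

lemma bessel_inequality:
  assumes e: "L2_orthonormal \<mu> e" and f: "square_integrable \<mu> (f :: _ \<Rightarrow> complex)" and A: "finite A"
  shows "(\<Sum>k\<in>A. (cmod (\<integral>x. f x * cnj (e k x) \<partial>\<mu>))\<^sup>2) \<le> (L2_norm \<mu> f)\<^sup>2"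
proof -
  define c where "c k = (\<integral>x. f x * cnj (e k x) \<partial>\<mu>)" for k
  let ?S = "\<lambda>x. \<Sum>k\<in>A. c k * e k x"
  let ?s = "\<Sum>k\<in>A. (cmod (c k))\<^sup>2"
  note S = square_integrable_orthonormal_sum[OF e, of c A]
  have fS: "(\<integral>x. f x * cnj (?S x) \<partial>\<mu>) = complex_of_real ?s"
    unfolding integral_orthonormal_sum[OF e f A] c_def[symmetric] of_real_sum complex_norm_square
    by (simp add: mult.commute)
  have "(\<integral>x. ?S x * cnj (f x) \<partial>\<mu>) = cnj (\<integral>x. f x * cnj (?S x) \<partial>\<mu>)"
    unfolding Bochner_Integration.integral_cnj[symmetric] by (simp add: mult.commute)
  then have Sf: "(\<integral>x. ?S x * cnj (f x) \<partial>\<mu>) = complex_of_real ?s"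
    using fS by simp
  have SS: "(\<integral>x. ?S x * cnj (?S x) \<partial>\<mu>) = complex_of_real ?s"
    using L2_norm_orthonormal_sum[OF e A, of c]
    unfolding integral_norm_square_complex[symmetric] L2_norm_square by simp
  have "complex_of_real (\<integral>x. (norm (f x - ?S x))\<^sup>2 \<partial>\<mu>)
      = (\<integral>x. f x * cnj (f x) - f x * cnj (?S x) - (?S x * cnj (f x) - ?S x * cnj (?S x)) \<partial>\<mu>)"
    unfolding integral_norm_square_complex by (simp only: complex_cnj_diff algebra_simps)
  also have "\<dots> = complex_of_real ((\<integral>x. (norm (f x))\<^sup>2 \<partial>\<mu>)) - of_real ?s"
    unfolding integral_norm_square_complex
    by (subst Bochner_Integration.integral_diff Bochner_Integration.integral_diff, (intro Bochner_Integration.integrable_diff square_integrable_integrable_mult_cnj f S)+)+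
      (simp only: fS Sf SS, simp)
  finally have "(\<integral>x. (norm (f x - ?S x))\<^sup>2 \<partial>\<mu>) = (\<integral>x. (norm (f x))\<^sup>2 \<partial>\<mu>) - ?s"
    unfolding of_real_diff[symmetric] of_real_eq_iff .
  moreover have "0 \<le> (\<integral>x. (norm (f x - ?S x))\<^sup>2 \<partial>\<mu>)" by simp
  ultimately show ?thesis unfolding L2_norm_square c_def by simp
qed

section \<open>Completeness and orthogonal series\<close>

text \<open>A rapidly Cauchy subsequence converges almost everywhere, and Fatou's lemma turns its
  pointwise limit into the limit of the whole sequence in \<open>L^2\<close>.\<close>

lemma L2_complete:
  fixes S :: "nat \<Rightarrow> 'x \<Rightarrow> complex"
  assumes S: "\<And>n. square_integrable \<mu> (S n)"
    and Cauchy: "\<And>\<epsilon>. \<epsilon> > 0 \<Longrightarrow> \<exists>N. \<forall>m\<ge>N. \<forall>n\<ge>N. (L2_norm \<mu> (\<lambda>x. S m x - S n x))\<^sup>2 < \<epsilon>"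
  obtains h where "square_integrable \<mu> h" "(\<lambda>n. L2_norm \<mu> (\<lambda>x. h x - S n x)) \<longlonglongrightarrow> 0"
proof -
  \<comment> \<open>The rate 1/4 beats the weights \<open>2^i\<close> used below and leaves a
    geometric series of ratio 1/2.\<close>
  have "\<exists>N. \<forall>m\<ge>N. \<forall>n\<ge>N. (L2_norm \<mu> (\<lambda>x. S m x - S n x))\<^sup>2 < (1/4)^i" for i :: nat
    by (rule Cauchy) simp
  then obtain N where N: "\<And>i m n. m \<ge> N i \<Longrightarrow> n \<ge> N i \<Longrightarrow> (L2_norm \<mu> (\<lambda>x. S m x - S n x))\<^sup>2 < (1/4)^i"
    by metis
  \<comment> \<open>Partial sums make \<open>r i\<close> dominate all thresholds \<open>N p\<close>
    with \<open>p \<le> i\<close> at once.\<close>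
  define r where "r i = (\<Sum>k\<le>i. N k)" for i
  have r_ge: "N p \<le> r i" if "p \<le> i" for p i
    unfolding r_def using that by (intro member_le_sum) auto
  have nn: "(\<integral>\<^sup>+x. ennreal ((cmod (S m x - S n x))\<^sup>2) \<partial>\<mu>) \<le> ennreal ((1/4)^i)"
    if "m \<ge> N i" "n \<ge> N i" for m n i
  proof -
    have "(\<integral>\<^sup>+x. ennreal ((cmod (S m x - S n x))\<^sup>2) \<partial>\<mu>) = ennreal (\<integral>x. (cmod (S m x - S n x))\<^sup>2 \<partial>\<mu>)"
      using square_integrable_diff[OF S S, of m n]
      by (intro nn_integral_eq_integral) (auto simp: square_integrable_def)
    then show ?thesis using N[OF that] by (simp add: L2_norm_square ennreal_leI)
  qed
  have [measurable]: "S n \<in> borel_measurable \<mu>" for n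
    using S[of n] by (simp add: square_integrable_def)
  define D where "D i x = S (r (Suc i)) x - S (r i) x" for i x
  have [measurable]: "D i \<in> borel_measurable \<mu>" for i
    unfolding D_def by measurable
  have "(\<integral>\<^sup>+x. (\<Sum>i. ennreal (2^i * (cmod (D i x))\<^sup>2)) \<partial>\<mu>) = (\<Sum>i. \<integral>\<^sup>+x. ennreal (2^i * (cmod (D i x))\<^sup>2) \<partial>\<mu>)"
    by (rule nn_integral_suminf) measurable
  also have "\<dots> \<le> (\<Sum>i. ennreal ((1/2)^i))"
  proof (rule suminf_le)
    fix i
    have "(\<integral>\<^sup>+x. ennreal (2^i * (cmod (D i x))\<^sup>2) \<partial>\<mu>) = ennreal (2^i) * (\<integral>\<^sup>+x. ennreal ((cmod (D i x))\<^sup>2) \<partial>\<mu>)"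
      by (subst nn_integral_cmult[symmetric]) (auto simp: ennreal_mult)
    also have "\<dots> \<le> ennreal (2^i) * ennreal ((1/4)^i)"
      unfolding D_def by (intro mult_left_mono nn r_ge) auto
    also have "\<dots> = ennreal ((1/2)^i)"
      by (simp add: ennreal_mult[symmetric] power_mult_distrib[symmetric] del: ennreal_power)
    finally show "(\<integral>\<^sup>+x. ennreal (2^i * (cmod (D i x))\<^sup>2) \<partial>\<mu>) \<le> ennreal ((1/2)^i)" .
  qed auto
  also have "\<dots> = ennreal (\<Sum>i. (1/2)^i)"
    by (rule suminf_ennreal2) (auto intro: summable_geometric)
  finally have "(\<integral>\<^sup>+x. (\<Sum>i. ennreal (2^i * (cmod (D i x))\<^sup>2)) \<partial>\<mu>) \<noteq> \<infinity>"
    by (auto simp: top_unique)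
  then have "AE x in \<mu>. (\<Sum>i. ennreal (2^i * (cmod (D i x))\<^sup>2)) \<noteq> \<infinity>"
    by (intro nn_integral_PInf_AE) auto
  \<comment> \<open>Off the null set of divergence \<open>lim\<close> still has some value; defining
    \<open>h\<close> by it everywhere makes \<open>h\<close> measurable.\<close>
  define h where "h x = lim (\<lambda>i. S (r i) x)" for x
  have lim: "AE x in \<mu>. (\<lambda>i. S (r i) x) \<longlonglongrightarrow> h x"
    using \<open>AE x in \<mu>. (\<Sum>i. ennreal (2^i * (cmod (D i x))\<^sup>2)) \<noteq> \<infinity>\<close>
  proof (rule AE_mp, intro AE_I2 impI)
    fix x
    assume fin: "(\<Sum>i. ennreal (2^i * (cmod (D i x))\<^sup>2)) \<noteq> \<infinity>"
    have s: "summable (\<lambda>i. 2^i * (cmod (D i x))\<^sup>2)"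
      by (rule summable_suminf_not_top) (use fin in auto)
    \<comment> \<open>Expanding a square bounds twice the modulus, so the weighted summability of
      squares yields absolute summability of the increments.\<close>
    have bd: "cmod (D i x) \<le> (1/2)^i + 2^i * (cmod (D i x))\<^sup>2" for i
    proof -
      have "0 \<le> (1/2)^i * (1 - 2^i * cmod (D i x))\<^sup>2" by simp
      also have "\<dots> = (1/2)^i - 2 * cmod (D i x) + 2^i * (cmod (D i x))\<^sup>2"
        by (simp add: power2_eq_square algebra_simps power_one_over)
      finally show ?thesis using norm_ge_zero[of "D i x"] by linarith
    qed
    have "summable (\<lambda>i. (1/2)^i + 2^i * (cmod (D i x))\<^sup>2)"
      by (intro summable_add s summable_geometric) simp
    then have "summable (\<lambda>i. D i x)"
      by (rule summable_comparison_test') (use bd in auto)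
    then have "(\<lambda>n. S (r 0) x + (\<Sum>i<n. D i x)) \<longlonglongrightarrow> S (r 0) x + (\<Sum>i. D i x)"
      by (intro tendsto_add tendsto_const summable_LIMSEQ)
    moreover have "S (r 0) x + (\<Sum>i<n. D i x) = S (r n) x" for n
      unfolding D_def by (subst sum_lessThan_telescope) simp
    ultimately have "convergent (\<lambda>i. S (r i) x)"
      by (auto simp: convergent_def)
    then show "(\<lambda>i. S (r i) x) \<longlonglongrightarrow> h x"
      unfolding h_def by (simp add: convergent_LIMSEQ_iff)
  qed
  have [measurable]: "h \<in> borel_measurable \<mu>"
    unfolding h_def by measurable
  \<comment> \<open>Here \<open>n\<close> is fixed and the limit is taken along the subsequence
    \<open>r\<close>.\<close>
  have Fatou: "(\<integral>\<^sup>+x. ennreal ((cmod (h x - S n x))\<^sup>2) \<partial>\<mu>) \<le> ennreal ((1/4)^p)" if n: "n \<ge> N p" for n p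
  proof -
    have "(\<integral>\<^sup>+x. ennreal ((cmod (h x - S n x))\<^sup>2) \<partial>\<mu>)
        = (\<integral>\<^sup>+x. liminf (\<lambda>i. ennreal ((cmod (S (r i) x - S n x))\<^sup>2)) \<partial>\<mu>)"
      using lim
    proof (intro nn_integral_cong_AE, elim AE_mp, intro AE_I2 impI)
      fix x assume "(\<lambda>i. S (r i) x) \<longlonglongrightarrow> h x"
      then have "(\<lambda>i. ennreal ((cmod (S (r i) x - S n x))\<^sup>2)) \<longlonglongrightarrow> ennreal ((cmod (h x - S n x))\<^sup>2)"
        by (intro tendsto_intros)
      then show "ennreal ((cmod (h x - S n x))\<^sup>2) = liminf (\<lambda>i. ennreal ((cmod (S (r i) x - S n x))\<^sup>2))"
        by (intro lim_imp_Liminf[symmetric]) auto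
    qed
    also have "\<dots> \<le> liminf (\<lambda>i. \<integral>\<^sup>+x. ennreal ((cmod (S (r i) x - S n x))\<^sup>2) \<partial>\<mu>)"
      by (rule nn_integral_liminf) measurable
    also have "\<dots> \<le> liminf (\<lambda>i::nat. ennreal ((1/4)^p))"
      using n by (intro Liminf_mono eventually_sequentiallyI[of p] nn r_ge)
    also have "\<dots> = ennreal ((1/4)^p)"
      by (rule Liminf_const) simp
    finally show ?thesis .
  qed
  \<comment> \<open>Already the bound for \<open>p = 0\<close>, which is 1, makes the difference
    square-integrable; adding \<open>S (N 0)\<close> then gives \<open>h\<close> itself.\<close>
  have sq: "square_integrable \<mu> (\<lambda>x. h x - S n x)" if "n \<ge> N 0" for n
    unfolding square_integrable_def
  proof
    show "integrable \<mu> (\<lambda>x. (cmod (h x - S n x))\<^sup>2)"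
      using Fatou[OF that] by (intro integrableI_bounded) (auto simp: le_less_trans)
  qed measurable
  have "square_integrable \<mu> h"
    using square_integrable_add[OF sq[OF order_refl] S[of "N 0"]] by simp
  moreover have "(\<lambda>n. L2_norm \<mu> (\<lambda>x. h x - S n x)) \<longlonglongrightarrow> 0"
  proof -
    \<comment> \<open>The threshold \<open>r p\<close> lies above both \<open>N p\<close>, for the
      bound, and \<open>N 0\<close>, for integrability.\<close>
    have bd: "(L2_norm \<mu> (\<lambda>x. h x - S n x))\<^sup>2 \<le> (1/4)^p" if "n \<ge> r p" for n p
    proof -
      have np: "n \<ge> N p" and n0: "n \<ge> N 0" using that r_ge[of p p] r_ge[of 0 p] by auto
      have "ennreal (\<integral>x. (cmod (h x - S n x))\<^sup>2 \<partial>\<mu>) = (\<integral>\<^sup>+x. ennreal ((cmod (h x - S n x))\<^sup>2) \<partial>\<mu>)"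
        using sq[OF n0] by (intro nn_integral_eq_integral[symmetric]) (auto simp: square_integrable_def)
      with Fatou[OF np] have "ennreal (\<integral>x. (cmod (h x - S n x))\<^sup>2 \<partial>\<mu>) \<le> ennreal ((1/4)^p)"
        by simp
      then show ?thesis unfolding L2_norm_square by (subst (asm) ennreal_le_iff) auto
    qed
    have "(\<lambda>n. (L2_norm \<mu> (\<lambda>x. h x - S n x))\<^sup>2) \<longlonglongrightarrow> 0"
    proof (rule LIMSEQ_I)
      fix \<epsilon> :: real assume "\<epsilon> > 0"
      then obtain p where p: "(1/4)^p < \<epsilon>" using real_arch_pow_inv[of \<epsilon> "1/4"] by auto
      show "\<exists>no. \<forall>n\<ge>no. norm ((L2_norm \<mu> (\<lambda>x. h x - S n x))\<^sup>2 - 0) < \<epsilon>"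
        using bd[of p] p by (intro exI[of _ "r p"]) (auto intro: le_less_trans)
    qed
    then show ?thesis by (simp add: tendsto_null_power)
  qed
  ultimately show ?thesis by (rule that)
qed

text \<open>By Pythagoras the squared distance of two partial sums is a block of the convergent
  series of squares, so the partial sums are Cauchy and completeness applies.\<close>

lemma riesz_fischer:
  assumes e: "L2_orthonormal \<mu> e" and c: "summable (\<lambda>k. (cmod (c k))\<^sup>2)"
  obtains h where "square_integrable \<mu> h"
    "(\<lambda>N. L2_norm \<mu> (\<lambda>x. h x - (\<Sum>k<N. c k * e k x))) \<longlonglongrightarrow> 0"
proof (rule L2_complete[where \<mu> = \<mu> and S = "\<lambda>N x. \<Sum>k<N. c k * e k x"])
  show "square_integrable \<mu> (\<lambda>x. \<Sum>k<n. c k * e k x)" for n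
    by (rule square_integrable_orthonormal_sum[OF e])
  fix \<epsilon> :: real assume "\<epsilon> > 0"
  with c obtain N where N: "\<And>m n. m \<ge> N \<Longrightarrow> norm (\<Sum>k=m..<n. (cmod (c k))\<^sup>2) < \<epsilon>"
    unfolding summable_Cauchy by metis
  have eq: "(\<Sum>k<n. c k * e k x) - (\<Sum>k<m. c k * e k x) = (\<Sum>k=m..<n. c k * e k x)"
    if "m \<le> n" for m n x
    using that by (metis lessThan_atLeast0 sum_diff_nat_ivl zero_le)
  have lt: "(L2_norm \<mu> (\<lambda>x. (\<Sum>k<n. c k * e k x) - (\<Sum>k<m. c k * e k x)))\<^sup>2 < \<epsilon>"
    if "N \<le> m" "m \<le> n" for m n
    using N[OF that(1), of n] unfolding eq[OF that(2)] by (simp add: L2_norm_orthonormal_sum[OF e])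
  show "\<exists>N. \<forall>m\<ge>N. \<forall>n\<ge>N. (L2_norm \<mu> (\<lambda>x. (\<Sum>k<m. c k * e k x) - (\<Sum>k<n. c k * e k x)))\<^sup>2 < \<epsilon>"
  proof (intro exI[of _ N] allI impI)
    fix m n assume mn: "N \<le> m" "N \<le> n"
    have sym: "L2_norm \<mu> (\<lambda>x. f x - g x) = L2_norm \<mu> (\<lambda>x. g x - f x)" for f g :: "'a \<Rightarrow> complex"
      unfolding L2_norm_def by (simp add: norm_minus_commute)
    show "(L2_norm \<mu> (\<lambda>x. (\<Sum>k<m. c k * e k x) - (\<Sum>k<n. c k * e k x)))\<^sup>2 < \<epsilon>"
    proof (cases "m \<le> n")
      case True then show ?thesis using lt[OF mn(1)] by (subst sym) simp
    next
      case False then show ?thesis using lt[OF mn(2), of m] by simp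
    qed
  qed
qed (use that in blast)

text \<open>Young's inequality in the role of Minkowski's: for small \<delta> the factor of
  \<open>g\<close> is close to 1, while that of \<open>f\<close> is harmless when \<open>f\<close>
  tends to 0.\<close>

lemma L2_norm_add_square_le:
  fixes f g :: "'x \<Rightarrow> complex"
  assumes f: "square_integrable \<mu> f" and g: "square_integrable \<mu> g" and "\<delta> > 0"
  shows "(L2_norm \<mu> (\<lambda>x. f x + g x))\<^sup>2 \<le> (1 + 1/\<delta>) * (L2_norm \<mu> f)\<^sup>2 + (1 + \<delta>) * (L2_norm \<mu> g)\<^sup>2"
proof -
  have i: "integrable \<mu> (\<lambda>x. (cmod (f x))\<^sup>2)" "integrable \<mu> (\<lambda>x. (cmod (g x))\<^sup>2)"
    using f g by (auto simp: square_integrable_def)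
  have "(\<integral>x. (cmod (f x + g x))\<^sup>2 \<partial>\<mu>) \<le> (\<integral>x. (1 + 1/\<delta>) * (cmod (f x))\<^sup>2 + (1 + \<delta>) * (cmod (g x))\<^sup>2 \<partial>\<mu>)"
  proof (rule integral_mono)
    show "integrable \<mu> (\<lambda>x. (cmod (f x + g x))\<^sup>2)"
      using square_integrable_add[OF f g] by (simp add: square_integrable_def)
    fix x
    have "(cmod (f x + g x))\<^sup>2 \<le> (cmod (f x) + cmod (g x))\<^sup>2"
      by (intro power_mono norm_triangle_ineq) auto
    \<comment> \<open>The added square is exactly what cancels the mixed term.\<close>
    also have "\<dots> \<le> (cmod (f x) + cmod (g x))\<^sup>2 + (cmod (f x) - \<delta> * cmod (g x))\<^sup>2 / \<delta>"
      using \<open>\<delta> > 0\<close> by simp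
    also have "\<dots> = (1 + 1/\<delta>) * (cmod (f x))\<^sup>2 + (1 + \<delta>) * (cmod (g x))\<^sup>2"
      using \<open>\<delta> > 0\<close> by (simp add: power2_eq_square field_simps)
    finally show "(cmod (f x + g x))\<^sup>2 \<le> (1 + 1/\<delta>) * (cmod (f x))\<^sup>2 + (1 + \<delta>) * (cmod (g x))\<^sup>2" .
  qed (use i in simp)
  also have "\<dots> = (1 + 1/\<delta>) * (\<integral>x. (cmod (f x))\<^sup>2 \<partial>\<mu>) + (1 + \<delta>) * (\<integral>x. (cmod (g x))\<^sup>2 \<partial>\<mu>)"
    using i by simp
  finally show ?thesis unfolding L2_norm_square .
qed

text \<open>Split \<open>h\<close> into remainder and partial sum. For fixed \<delta> the remainder
  disappears as \<open>N\<close> grows; afterwards \<delta> tends to 0.\<close>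

lemma L2_norm_series_le:
  assumes e: "L2_orthonormal \<mu> e" and c: "summable (\<lambda>k. (cmod (c k))\<^sup>2)"
    and h: "square_integrable \<mu> h"
    and lim: "(\<lambda>N. L2_norm \<mu> (\<lambda>x. h x - (\<Sum>k<N. c k * e k x))) \<longlonglongrightarrow> 0"
  shows "(L2_norm \<mu> h)\<^sup>2 \<le> (\<Sum>k. (cmod (c k))\<^sup>2)"
proof -
  let ?B = "\<Sum>k. (cmod (c k))\<^sup>2"
  have B: "(L2_norm \<mu> h)\<^sup>2 \<le> (1 + \<delta>) * ?B" if "\<delta> > 0" for \<delta>
  proof -
    have "(\<lambda>N. (1 + 1/\<delta>) * (L2_norm \<mu> (\<lambda>x. h x - (\<Sum>k<N. c k * e k x)))\<^sup>2
        + (1 + \<delta>) * (\<Sum>k<N. (cmod (c k))\<^sup>2)) \<longlonglongrightarrow> (1 + 1/\<delta>) * 0\<^sup>2 + (1 + \<delta>) * ?B"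
      by (intro tendsto_intros lim summable_LIMSEQ c)
    moreover have "(L2_norm \<mu> h)\<^sup>2 \<le> (1 + 1/\<delta>) * (L2_norm \<mu> (\<lambda>x. h x - (\<Sum>k<N. c k * e k x)))\<^sup>2
        + (1 + \<delta>) * (\<Sum>k<N. (cmod (c k))\<^sup>2)" for N
    proof -
      note S = square_integrable_orthonormal_sum[OF e, of c "{..<N}"]
      show ?thesis
        using L2_norm_add_square_le[OF square_integrable_diff[OF h S] S that]
        by (simp add: L2_norm_orthonormal_sum[OF e])
    qed
    ultimately show ?thesis by (auto intro: LIMSEQ_le_const)
  qed
  have "((\<lambda>\<delta>. (1 + \<delta>) * ?B) \<longlongrightarrow> (1 + 0) * ?B) (at_right 0)"
    by (intro tendsto_intros)
  then have "(L2_norm \<mu> h)\<^sup>2 \<le> (1 + 0) * ?B"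
    by (rule tendsto_lowerbound) (auto simp: eventually_at_right_less intro!: eventually_mono[OF eventually_at_right_less] B)
  then show ?thesis by simp
qed

section \<open>Energy of the scattering transform\<close>

text \<open>The squares are differences of consecutive values of \<open>a\<close>, so over a
  symmetric range of scales they telescope. As \<open>ev k \<ge> 0\<close>, all arguments stay in
  the half-line where \<open>G\<close> is decreasing and at most \<open>G 0\<close>.\<close>

lemma wavelet_coeff_sum_le:
  assumes G0: "\<And>x. x \<ge> 0 \<Longrightarrow> G x \<ge> 0" and G: "antimono_on {0..} G" and ev: "ev k \<ge> 0" and J: "finite J"
  shows "(\<Sum>j\<in>J. (wavelet_coeff G ev j k)\<^sup>2) \<le> (G 0)\<^sup>2"
proof -
  define a where "a j = (G (2 powi j * ev k))\<^sup>2" for j :: int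
  have nn: "2 powi j * ev k \<ge> 0" for j using ev by simp
  \<comment> \<open>Makes the radicand in \<open>wavelet_coeff\<close> nonnegative, so that squaring
    undoes the root.\<close>
  have mono: "a j \<le> a (j - 1)" for j
  proof -
    have "(2::real) powi (j - 1) \<le> 2 powi j" by (intro power_int_increasing) auto
    then have "2 powi (j - 1) * ev k \<le> 2 powi j * ev k" using ev by (intro mult_right_mono)
    then have "G (2 powi j * ev k) \<le> G (2 powi (j - 1) * ev k)"
      using nn by (intro monotone_onD[OF G]) auto
    then show ?thesis unfolding a_def by (intro power_mono G0 nn)
  qed
  have w: "(wavelet_coeff G ev j k)\<^sup>2 = a (j - 1) - a j" for j
    using mono[of j] by (simp add: wavelet_coeff_def a_def)
  \<comment> \<open>The interval excludes its left end, hence the added 1 in the witness.\<close>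
  obtain n :: nat where n: "J \<subseteq> {- int n <..int n}"
  proof -
    have b: "\<bar>j\<bar> \<le> (\<Sum>i\<in>J. \<bar>i\<bar>)" if "j \<in> J" for j
      using that J by (intro member_le_sum) auto
    show ?thesis by (rule that[of "nat ((\<Sum>i\<in>J. \<bar>i\<bar>) + 1)"]) (use b in force)
  qed
  have tele: "(\<Sum>j\<in>{- int n <..int n}. a (j - 1) - a j) = a (- int n) - a (int n)" for n
  proof (induction n)
    case (Suc n)
    have "{- int (Suc n) <..int (Suc n)} = insert (- int n) (insert (int n + 1) {- int n <..int n})"
      by auto
    moreover have "a (- int n - 1) = a (- 1 - int n)" by (rule arg_cong[where f = a]) simp
    ultimately show ?case using Suc by (simp add: algebra_simps)
  qed simp
  have "(\<Sum>j\<in>J. (wavelet_coeff G ev j k)\<^sup>2) \<le> (\<Sum>j\<in>{- int n <..int n}. (wavelet_coeff G ev j k)\<^sup>2)"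
    by (rule sum_mono2) (use n in auto)
  also have "\<dots> = a (- int n) - a (int n)" unfolding w by (rule tele)
  also have "\<dots> \<le> a (- int n)" by (simp add: a_def)
  also have "\<dots> \<le> (G 0)\<^sup>2"
    unfolding a_def using nn by (intro power_mono G0 monotone_onD[OF G]) auto
  finally show ?thesis .
qed

section \<open>One scattering step and its iteration\<close>

context
  fixes \<mu> :: "'x measure" and ev :: "nat \<Rightarrow> real" and e :: "nat \<Rightarrow> 'x \<Rightarrow> complex" and G :: "real \<Rightarrow> real"
  assumes e: "L2_orthonormal \<mu> e" and ev: "\<And>k. ev k \<ge> 0"
    and G0: "\<And>x. x \<ge> 0 \<Longrightarrow> G x \<ge> 0" and G: "antimono_on {0..} G"
begin

lemma fourier_coeff_sum_le:
  assumes f: "square_integrable \<mu> f" and "finite A"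
  shows "(\<Sum>k\<in>A. (cmod (fourier_coeff \<mu> e f k))\<^sup>2) \<le> (L2_norm \<mu> f)\<^sup>2"
  using bessel_inequality[OF e square_integrable_of_real[OF f] \<open>finite A\<close>]
  by (simp add: fourier_coeff_def L2_norm_def)

text \<open>For each \<open>k\<close> the scales are summed first, by telescoping; Bessel's
  inequality then handles the sum over \<open>k\<close>. A single scale gives summability of the
  wavelet series, a general \<open>J\<close> the energy bound of a step.\<close>

lemma wavelet_series_sum_le:
  assumes f: "square_integrable \<mu> f" and J: "finite J" and A: "finite A"
  shows "(\<Sum>k\<in>A. \<Sum>j\<in>J. (cmod (fourier_coeff \<mu> e f k * complex_of_real (wavelet_coeff G ev j k)))\<^sup>2)
    \<le> (G 0)\<^sup>2 * (L2_norm \<mu> f)\<^sup>2"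
proof -
  have "(\<Sum>k\<in>A. \<Sum>j\<in>J. (cmod (fourier_coeff \<mu> e f k * complex_of_real (wavelet_coeff G ev j k)))\<^sup>2)
      = (\<Sum>k\<in>A. (cmod (fourier_coeff \<mu> e f k))\<^sup>2 * (\<Sum>j\<in>J. (wavelet_coeff G ev j k)\<^sup>2))"
    by (simp add: norm_mult power_mult_distrib sum_distrib_left)
  also have "\<dots> \<le> (\<Sum>k\<in>A. (cmod (fourier_coeff \<mu> e f k))\<^sup>2 * (G 0)\<^sup>2)"
    by (intro sum_mono mult_left_mono wavelet_coeff_sum_le[of G] G0 G ev J) auto
  also have "\<dots> = (G 0)\<^sup>2 * (\<Sum>k\<in>A. (cmod (fourier_coeff \<mu> e f k))\<^sup>2)"
    by (simp add: sum_distrib_left mult.commute)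
  also have "\<dots> \<le> (G 0)\<^sup>2 * (L2_norm \<mu> f)\<^sup>2"
    by (intro mult_left_mono fourier_coeff_sum_le f A) auto
  finally show ?thesis .
qed

lemma wavelet_series_summable:
  assumes f: "square_integrable \<mu> f"
  shows "summable (\<lambda>k. (cmod (fourier_coeff \<mu> e f k * complex_of_real (wavelet_coeff G ev j k)))\<^sup>2)"
  by (rule bounded_imp_summable[where B = "(G 0)\<^sup>2 * (L2_norm \<mu> f)\<^sup>2"])
    (use wavelet_series_sum_le[OF f, of "{j}"] in auto)

text \<open>Riesz-Fischer supplies a limit of the series, so the function chosen in
  \<open>wavelet_conv\<close> really is one, and every such limit obeys the norm bound.\<close>

lemma
  assumes f: "square_integrable \<mu> f"
  shows square_integrable_wavelet_conv: "square_integrable \<mu> (wavelet_conv \<mu> ev e G j f)"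
    and L2_norm_wavelet_conv: "(L2_norm \<mu> (wavelet_conv \<mu> ev e G j f))\<^sup>2
      \<le> (\<Sum>k. (cmod (fourier_coeff \<mu> e f k * complex_of_real (wavelet_coeff G ev j k)))\<^sup>2)"
proof -
  note s = wavelet_series_summable[OF f, of j]
  define P where "P h \<longleftrightarrow> square_integrable \<mu> h \<and> (\<lambda>N. L2_norm \<mu> (\<lambda>x. h x -
      (\<Sum>k<N. fourier_coeff \<mu> e f k * complex_of_real (wavelet_coeff G ev j k) * e k x))) \<longlonglongrightarrow> 0" for h
  have "\<exists>h. P h" unfolding P_def by (rule riesz_fischer[OF e s]) blast
  then have "P (wavelet_conv \<mu> ev e G j f)"
    unfolding wavelet_conv_def P_def by (rule someI_ex)
  then show "square_integrable \<mu> (wavelet_conv \<mu> ev e G j f)"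
    and "(L2_norm \<mu> (wavelet_conv \<mu> ev e G j f))\<^sup>2
      \<le> (\<Sum>k. (cmod (fourier_coeff \<mu> e f k * complex_of_real (wavelet_coeff G ev j k)))\<^sup>2)"
    unfolding P_def using L2_norm_series_le[OF e s] by blast+
qed

lemma square_integrable_scatter_step:
  assumes "square_integrable \<mu> f"
  shows "square_integrable \<mu> (scatter_step \<mu> ev e G j f)"
  using square_integrable_wavelet_conv[OF assms, of j]
  by (auto simp: square_integrable_def scatter_step_def)

text \<open>The modulus preserves the norm, and since \<open>J\<close> is finite the sums over
  scales and frequencies may be exchanged.\<close>

lemma L2_norm_scatter_step_sum_le:
  assumes f: "square_integrable \<mu> f" and J: "finite J"
  shows "(\<Sum>j\<in>J. (L2_norm \<mu> (scatter_step \<mu> ev e G j f))\<^sup>2) \<le> (G 0)\<^sup>2 * (L2_norm \<mu> f)\<^sup>2"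
proof -
  let ?c = "\<lambda>j k. (cmod (fourier_coeff \<mu> e f k * complex_of_real (wavelet_coeff G ev j k)))\<^sup>2"
  note s = wavelet_series_summable[OF f]
  have "(\<Sum>j\<in>J. (L2_norm \<mu> (scatter_step \<mu> ev e G j f))\<^sup>2) = (\<Sum>j\<in>J. (L2_norm \<mu> (wavelet_conv \<mu> ev e G j f))\<^sup>2)"
    by (simp add: scatter_step_def L2_norm_def)
  also have "\<dots> \<le> (\<Sum>j\<in>J. \<Sum>k. ?c j k)"
    by (intro sum_mono L2_norm_wavelet_conv f)
  also have "\<dots> = (\<Sum>k. \<Sum>j\<in>J. ?c j k)"
    by (rule suminf_sum[symmetric]) (rule s)
  also have "\<dots> \<le> (G 0)\<^sup>2 * (L2_norm \<mu> f)\<^sup>2"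
    by (intro suminf_le_const summable_sum s wavelet_series_sum_le f J) auto
  finally show ?thesis .
qed

text \<open>Induction on the length of paths. The head of a path acts first, so its tail scatters
  \<open>scatter_step\<close> of \<open>f\<close>; this is why \<open>f\<close> is generalised. Each
  scale applied costs a factor \<open>(G 0)\<^sup>2\<close>.\<close>

lemma scattering_sum_le:
  assumes "square_integrable \<mu> f" and J: "finite J"
  shows "(\<Sum>js | set js \<subseteq> J \<and> length js = m. \<bar>scattering \<mu> ev e G f js\<bar>\<^sup>2) \<le> (G 0) ^ (2 * m) * (L2_norm \<mu> f)\<^sup>2"
  using assms(1)
proof (induction m arbitrary: f)
  case 0
  have "{js. set js \<subseteq> J \<and> length js = 0} = {[]}" by auto
  then show ?case by (simp add: scattering_def)
next
  case (Suc m)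
  let ?L = "{js. set js \<subseteq> J \<and> length js = m}"
  have L: "{js. set js \<subseteq> J \<and> length js = Suc m} = (\<lambda>(j, js). j # js) ` (J \<times> ?L)"
    by (auto simp: length_Suc_conv image_iff)
  have inj: "inj_on (\<lambda>(j, js). j # js) (J \<times> ?L)" by (auto simp: inj_on_def)
  have "(\<Sum>js | set js \<subseteq> J \<and> length js = Suc m. \<bar>scattering \<mu> ev e G f js\<bar>\<^sup>2)
      = (\<Sum>j\<in>J. \<Sum>js\<in>?L. \<bar>scattering \<mu> ev e G (scatter_step \<mu> ev e G j f) js\<bar>\<^sup>2)"
    unfolding L sum.reindex[OF inj] sum.cartesian_product
    by (simp add: scattering_def case_prod_unfold)
  also have "\<dots> \<le> (\<Sum>j\<in>J. (G 0) ^ (2 * m) * (L2_norm \<mu> (scatter_step \<mu> ev e G j f))\<^sup>2)"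
    by (intro sum_mono Suc.IH square_integrable_scatter_step Suc.prems)
  also have "\<dots> = (G 0) ^ (2 * m) * (\<Sum>j\<in>J. (L2_norm \<mu> (scatter_step \<mu> ev e G j f))\<^sup>2)"
    by (simp add: sum_distrib_left)
  also have "\<dots> \<le> (G 0) ^ (2 * m) * ((G 0)\<^sup>2 * (L2_norm \<mu> f)\<^sup>2)"
    using G0[of 0] by (intro mult_left_mono L2_norm_scatter_step_sum_le Suc.prems J) auto
  also have "\<dots> = (G 0) ^ (2 * Suc m) * (L2_norm \<mu> f)\<^sup>2"
    by (simp add: power_add power2_eq_square)
  finally show ?case .
qed

text \<open>The terms are nonnegative, so a uniform bound on finite partial sums gives both
  summability and the bound on the total.\<close>

lemma scattering_summable_bound:
  assumes f: "square_integrable \<mu> f"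
  shows "(\<lambda>js. \<bar>scattering \<mu> ev e G f js\<bar>\<^sup>2) summable_on {js. length js = m}"
    and "(\<Sum>\<^sub>\<infinity>js\<in>{js. length js = m}. \<bar>scattering \<mu> ev e G f js\<bar>\<^sup>2) \<le> (G 0) ^ (2 * m) * (L2_norm \<mu> f)\<^sup>2"
proof -
  let ?s = "\<lambda>js. \<bar>scattering \<mu> ev e G f js\<bar>\<^sup>2"
  have fin: "sum ?s F \<le> (G 0) ^ (2 * m) * (L2_norm \<mu> f)\<^sup>2"
    if "finite F" "F \<subseteq> {js. length js = m}" for F
  proof -
    \<comment> \<open>Finitely many paths involve finitely many scales, so \<open>F\<close> lies in
      the finite set of all paths of length \<open>m\<close> over \<open>?J\<close>.\<close>
    let ?J = "\<Union>js\<in>F. set js"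
    have "sum ?s F \<le> (\<Sum>js | set js \<subseteq> ?J \<and> length js = m. ?s js)"
      using that by (intro sum_mono2 finite_lists_length_eq) auto
    also have "\<dots> \<le> (G 0) ^ (2 * m) * (L2_norm \<mu> f)\<^sup>2"
      by (rule scattering_sum_le[OF f]) (use that in auto)
    finally show ?thesis .
  qed
  show s: "?s summable_on {js. length js = m}"
    by (rule nonneg_bdd_above_summable_on) (use fin in \<open>auto intro!: bdd_aboveI2\<close>)
  show "infsum ?s {js. length js = m} \<le> (G 0) ^ (2 * m) * (L2_norm \<mu> f)\<^sup>2"
    by (rule infsum_le_finite_sums[OF s fin])
qed

end

theorem corollary10:
  fixes M :: "(real^'d::finite) set"
    and g :: "real^'d \<Rightarrow> real^'d \<Rightarrow> real^'d \<Rightarrow> real"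
    and \<mu> :: "(real^'d) measure"
    and ev :: "nat \<Rightarrow> real"
    and e :: "nat \<Rightarrow> real^'d \<Rightarrow> complex"
    and G :: "real \<Rightarrow> real"
    and C :: real
    and f :: "real^'d \<Rightarrow> real"
    and m :: nat
  assumes "compact M"
    and "smooth_submanifold TYPE('n::finite) M"
    and "riemannian_metric TYPE('n) M g"
    and "riemannian_volume TYPE('n) M g \<mu>"
    and "mono ev"
    and "\<forall>k. smooth_function TYPE('n) M (e k) \<and>
           (\<forall>p\<in>M. - laplace_beltrami TYPE('n) M g (e k) p = ev k *\<^sub>R e k p)"
    and "L2_orthonormal_basis \<mu> e"
    and "\<forall>x\<ge>0. G x \<ge> 0"
    and "antimono_on {0..} G"
    and "continuous_on {0..} G"
    and "G 0 = C" and "0 < C"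
    and "(G \<longlongrightarrow> 0) at_top"
    and "square_integrable \<mu> f"
    and "m \<ge> 1"
  shows "(\<lambda>js. \<bar>scattering \<mu> ev e G f js\<bar>\<^sup>2) summable_on {js. length js = m} \<and>
         (\<Sum>\<^sub>\<infinity>js\<in>{js. length js = m}. \<bar>scattering \<mu> ev e G f js\<bar>\<^sup>2) \<le> C ^ (2 * m) * (L2_norm \<mu> f)\<^sup>2"
proof -
  have "ev k \<ge> 0" for k
  proof -
    \<comment> \<open>An eigenfunction has norm 1, so it cannot vanish on all of \<open>M\<close>,
      the space of \<mu>.\<close>
    obtain q where "q \<in> M" "e k q \<noteq> 0"
    proof (rule ccontr)
      assume "\<not> thesis"
      with that have "e k q = 0" if "q \<in> M" for q using \<open>q \<in> M\<close> by blast
      moreover have "space \<mu> = M" using assms(4) by (simp add: riemannian_volume_def)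
      ultimately have "(\<integral>x. e k x * cnj (e k x) \<partial>\<mu>) = (\<integral>x. 0 \<partial>\<mu>)"
        by (intro Bochner_Integration.integral_cong) auto
      then show False using assms(7) by (simp add: L2_orthonormal_basis_def)
    qed
    with assms(6) show ?thesis
      by (intro eigenvalue_nonneg[OF assms(1-3), of "e k"]) auto
  qed
  moreover have "\<And>x. x \<ge> 0 \<Longrightarrow> G x \<ge> 0" using assms(8) by blast
  ultimately show ?thesis
    using scattering_summable_bound[of \<mu> e ev G f m] L2_orthonormal_basis_imp[OF assms(7)] assms(9,14)
    unfolding assms(11)[symmetric] by blast
qed

end
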